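(* Let $k,l,N$ be positive integers with at least one of $k,l$ odd. Suppose proper distributions $\varphi_1,\dots,\varphi_N$ on $\mathbb{T}^2$ satisfy $$-\partial_1^k\varphi_1=\mu_0,\qquad \partial_2^l\varphi_j-\partial_1^k\varphi_{j+1}=\mu_j\ (j=1,\dots,N-1),\qquad \partial_2^l\varphi_N=\mu_N,$$ where $\mu_0,\dots,\mu_N$ are (finite complex Borel) measures on $\mathbb{T}^2$. Then $$\sum_{j=1}^N\|\varphi_j\|_{W_2^{\frac{k-1}{2},\frac{l-1}{2}}(\mathbb{T}^2)}\leqslant C\sum_{j=0}^N\|\mu_j\|,$$ where $C$ does not depend on the $\varphi_j$ and $\mu_j$.
   Context: The torus is parametrised by $t\mapsto e^{2\pi i t}$, $\partial_1,\partial_2$ are the derivatives with respect to the two parameters, and Fourier coefficients are $\hat f(m,n)$, $(m,n)\in\mathbb{Z}^2$, with respect to the system $e^{2\pi i(mt_1+nt_2)}$. A distribution $f$ on $\mathbb{T}^2$ is called proper if $\hat f(s,t)=0$ whenever $s=0$ or $t=0$. For $\alpha,\beta\geqslant 0$, $W_2^{\alpha,\beta}(\mathbb{T}^2)$ is the space of distributions $f$ with $\{(1+m^2)^{\alpha/2}(1+n^2)^{\beta/2}\hat f(m,n)\}\in l^2(\mathbb{Z}^2)$, normed by the $l^2$-norm of this sequence. The norm $\|\mu\|$ of a measure is its total variation. *)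

theory Defs
  imports "HOL-Analysis.Analysis"
begin

text \<open>The torus T^2 is parametrised by (t1,t2) in [0,1) x [0,1) via t |-> exp(2 pi i t).\<close>
definition torus_space :: "(real \<times> real) set" where
  "torus_space = {0..<1} \<times> {0..<1}"

definition torus_borel :: "(real \<times> real) measure" where
  "torus_borel = restrict_space borel torus_space"

text \<open>A finite complex Borel measure on T^2 is represented as  mu(A) = integral over A of h d nu,
  with nu a finite (positive) Borel measure on T^2 and h a nu-integrable complex density
  (every complex measure has this form, e.g. with nu = |mu|).\<close>
definition is_cmeasure :: "(real \<times> real) measure \<Rightarrow> (real \<times> real \<Rightarrow> complex) \<Rightarrow> bool" where
  "is_cmeasure \<nu> h \<longleftrightarrow> sets \<nu> = sets torus_borel \<and> finite_measure \<nu> \<and> integrable \<nu> h"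

definition cmeasure_val :: "(real \<times> real) measure \<Rightarrow> (real \<times> real \<Rightarrow> complex) \<Rightarrow> (real \<times> real) set \<Rightarrow> complex" where
  "cmeasure_val \<nu> h A = set_lebesgue_integral \<nu> A h"

definition cmeasure_tv :: "(real \<times> real) measure \<Rightarrow> (real \<times> real \<Rightarrow> complex) \<Rightarrow> real" where
  "cmeasure_tv \<nu> h = Sup {(\<Sum>A\<in>P. cmod (cmeasure_val \<nu> h A)) | P.
      finite P \<and> P \<subseteq> sets \<nu> \<and> disjoint P}"

definition cmeasure_fourier :: "(real \<times> real) measure \<Rightarrow> (real \<times> real \<Rightarrow> complex) \<Rightarrow> int \<times> int \<Rightarrow> complex" where
  "cmeasure_fourier \<nu> h = (\<lambda>(m, n). integral\<^sup>L \<nu> (\<lambda>t. h t *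
      exp (- 2 * pi * \<i> * (of_int m * of_real (fst t) + of_int n * of_real (snd t)))))"

text \<open>Distributions on T^2 are identified with their Fourier coefficient sequences, which are
  exactly the sequences of at most polynomial growth.\<close>
definition is_distribution :: "(int \<times> int \<Rightarrow> complex) \<Rightarrow> bool" where
  "is_distribution f \<longleftrightarrow> (\<exists>C K. \<forall>m n. cmod (f (m, n)) \<le> C * (1 + \<bar>real_of_int m\<bar> + \<bar>real_of_int n\<bar>) ^ K)"

definition proper :: "(int \<times> int \<Rightarrow> complex) \<Rightarrow> bool" where
  "proper f \<longleftrightarrow> (\<forall>m n. (m = 0 \<or> n = 0) \<longrightarrow> f (m, n) = 0)"

text \<open>Fourier multipliers of partial derivatives: (d_1^k f)^(m,n) = (2 pi i m)^k f^(m,n).\<close>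
definition d1 :: "nat \<Rightarrow> (int \<times> int \<Rightarrow> complex) \<Rightarrow> int \<times> int \<Rightarrow> complex" where
  "d1 k f = (\<lambda>(m, n). (2 * pi * \<i> * of_int m) ^ k * f (m, n))"

definition d2 :: "nat \<Rightarrow> (int \<times> int \<Rightarrow> complex) \<Rightarrow> int \<times> int \<Rightarrow> complex" where
  "d2 l f = (\<lambda>(m, n). (2 * pi * \<i> * of_int n) ^ l * f (m, n))"

definition sob_weight_sq :: "real \<Rightarrow> real \<Rightarrow> (int \<times> int \<Rightarrow> complex) \<Rightarrow> int \<times> int \<Rightarrow> real" where
  "sob_weight_sq a b f = (\<lambda>(m, n). (1 + (real_of_int m)\<^sup>2) powr a * (1 + (real_of_int n)\<^sup>2) powr b * (cmod (f (m, n)))\<^sup>2)"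

definition in_W2 :: "real \<Rightarrow> real \<Rightarrow> (int \<times> int \<Rightarrow> complex) \<Rightarrow> bool" where
  "in_W2 a b f \<longleftrightarrow> sob_weight_sq a b f summable_on UNIV"

definition W2_norm :: "real \<Rightarrow> real \<Rightarrow> (int \<times> int \<Rightarrow> complex) \<Rightarrow> real" where
  "W2_norm a b f = sqrt (\<Sum>\<^sub>\<infinity>p. sob_weight_sq a b f p)"

end

theory Submission
  imports Defs "HOL-Computational_Algebra.Polynomial"
begin

text \<open>On the Fourier side the system forces \<open>\<Sum>\<^sub>j m\<^bsup>kj\<^esup> n\<^bsup>l(N-j)\<^esup> M\<^sub>j(m,n) = 0\<close>, where \<open>M\<^sub>j\<close> is a constant
  multiple of the Fourier transform of \<open>\<mu>\<^sub>j\<close>. Work at the scales \<open>a = 2\<^bsup>ls\<^esup>\<close>, \<open>b = 2\<^bsup>ks\<^esup>\<close>, so that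
  \<open>a\<^bsup>k\<^esup> = b\<^bsup>l\<^esup>\<close>. Averaging the squared modulus of this relation over \<open>0 < m \<le> Ra\<close>, \<open>0 < n \<le> Rb\<close> gives
  kernels \<open>g\<^sub>s\<^sub>,\<^sub>i\<^sub>j\<close> with \<open>\<Sum>\<^sub>i\<^sub>j g\<^sub>s\<^sub>,\<^sub>i\<^sub>j M\<^sub>i cnj M\<^sub>j = 0\<close>. Let \<open>T\<^sub>s\<^sub>,\<^sub>i\<^sub>j\<close> be the total mass of \<open>g\<^sub>s\<^sub>,\<^sub>i\<^sub>j\<close> and
  \<open>\<beta>\<^sub>s\<close> the uniform probability kernel on the box \<open>|m| \<le> a\<close>, \<open>|n| \<le> b\<close>. The kernels \<open>g\<^sub>s\<^sub>,\<^sub>i\<^sub>j - T\<^sub>s\<^sub>,\<^sub>i\<^sub>j \<beta>\<^sub>s\<close>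
  have mean zero, hence their sum over \<open>s\<close> has a bounded Fourier transform, and testing it against the
  measures bounds \<open>\<Sum>\<^sub>s \<Sum>\<^sub>m\<^sub>,\<^sub>n \<beta>\<^sub>s \<Sum>\<^sub>i\<^sub>j T\<^sub>s\<^sub>,\<^sub>i\<^sub>j M\<^sub>i cnj M\<^sub>j\<close> by \<open>C (\<Sum>\<^sub>j \<parallel>\<mu>\<^sub>j\<parallel>)\<^sup>2\<close>. As a Gram matrix of
  linearly independent monomials, \<open>T\<^sub>s\<close> is positive definite uniformly in \<open>s\<close>, and the resulting bound on
  \<open>\<Sum>\<^sub>s \<beta>\<^sub>s |M\<^sub>j|\<^sup>2\<close> dominates the Sobolev norm because \<open>max(|m|\<^bsup>k\<^esup>, |n|\<^bsup>l\<^esup>) |\<phi>\<^sub>j| \<le> \<Sum>\<^sub>i |M\<^sub>i|\<close>.\<close>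

subsection \<open>Trigonometric kernels adapted to a scale\<close>

definition trig :: "int set \<Rightarrow> (int \<Rightarrow> real) \<Rightarrow> complex \<Rightarrow> complex" where
  "trig I \<kappa> z = (\<Sum>m\<in>I. of_real (\<kappa> m) * z powi m)"

text \<open>What the transform of a kernel living at scale \<open>a\<close> satisfies: it is
  bounded, decays to first order once \<open>norm (1 - z)\<close> exceeds \<open>1 / a\<close>, and
  is Lipschitz at 1 with rate \<open>a\<close>. One order of decay is what kernels with a sharp
  cutoff offer.\<close>

definition adapted :: "real \<Rightarrow> real \<Rightarrow> (complex \<Rightarrow> complex) \<Rightarrow> bool" where
  "adapted C a u \<longleftrightarrow> (\<forall>z. norm z = 1 \<longrightarrow>
     norm (u z) \<le> C \<and> a * norm (1 - z) * norm (u z) \<le> C \<and> norm (u z - u 1) \<le> C * (a * norm (1 - z)))"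

lemma norm_power_diff_one_le:
  fixes z :: complex
  assumes "norm z = 1"
  shows "norm (z ^ n - 1) \<le> real n * norm (1 - z)"
proof (induction n)
  case (Suc n)
  have "z ^ Suc n - 1 = z * (z ^ n - 1) + (z - 1)"
    by (simp add: algebra_simps)
  then have "norm (z ^ Suc n - 1) \<le> norm (z * (z ^ n - 1)) + norm (z - 1)"
    by (metis norm_triangle_ineq)
  also have "\<dots> \<le> real n * norm (1 - z) + norm (1 - z)"
    using Suc assms by (simp add: norm_mult norm_minus_commute)
  finally show ?case
    by (simp add: algebra_simps)
qed simp

lemma norm_power_int_diff_one_le:
  fixes z :: complex
  assumes z: "norm z = 1"
  shows "norm (z powi m - 1) \<le> \<bar>real_of_int m\<bar> * norm (1 - z)"
proof (cases "m \<ge> 0")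
  case True
  then show ?thesis
    using norm_power_diff_one_le[OF z, of "nat m"] by (simp add: power_int_def)
next
  case False
  have z0: "z \<noteq> 0" using z by auto
  have "norm (z powi m - 1) = norm (z powi (-m)) * norm (z powi m - 1)"
    using z by (simp add: norm_power_int)
  also have "\<dots> = norm (z powi (-m) * z powi m - z powi (-m))"
    by (simp add: norm_mult[symmetric] right_diff_distrib)
  also have "z powi (-m) * z powi m = 1"
    using z0 by (simp add: power_int_minus)
  also have "z powi (-m) = z ^ nat (-m)"
    using False by (simp add: power_int_def)
  finally show ?thesis
    using norm_power_diff_one_le[OF z, of "nat (-m)"] False by (simp add: norm_minus_commute)
qed

lemma norm_trig_le:
  assumes "norm z = 1"
  shows "norm (trig I \<kappa> z) \<le> (\<Sum>m\<in>I. \<bar>\<kappa> m\<bar>)"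
  unfolding trig_def using assms
  by (intro sum_norm_le) (simp add: norm_mult norm_power_int)

text \<open>Only the frequencies with nonzero coefficient must lie within \<open>r\<close>: the
  bound sees the support of the kernel and not the window \<open>I\<close>, which may be far
  larger.\<close>

lemma norm_trig_diff_le:
  assumes z: "norm z = 1" and r: "\<And>m. m \<in> I \<Longrightarrow> \<kappa> m \<noteq> 0 \<Longrightarrow> \<bar>real_of_int m\<bar> \<le> r"
  shows "norm (trig I \<kappa> z - trig I \<kappa> 1) \<le> (\<Sum>m\<in>I. \<bar>\<kappa> m\<bar>) * (r * norm (1 - z))"
proof -
  have "trig I \<kappa> z - trig I \<kappa> 1 = (\<Sum>m\<in>I. of_real (\<kappa> m) * (z powi m - 1))"
    by (simp add: trig_def sum_subtractf algebra_simps)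
  also have "norm \<dots> \<le> (\<Sum>m\<in>I. \<bar>\<kappa> m\<bar> * (r * norm (1 - z)))"
  proof (intro sum_norm_le)
    fix m assume m: "m \<in> I"
    show "norm (of_real (\<kappa> m) * (z powi m - 1)) \<le> \<bar>\<kappa> m\<bar> * (r * norm (1 - z))"
    proof (cases "\<kappa> m = 0")
      case False
      have "norm (z powi m - 1) \<le> r * norm (1 - z)"
        using norm_power_int_diff_one_le[OF z, of m] mult_right_mono[OF r[OF m False], of "norm (1 - z)"]
        by simp
      then show ?thesis
        by (simp add: norm_mult mult_left_mono)
    qed simp
  qed
  finally show ?thesis
    by (simp add: sum_distrib_right)
qed

text \<open>Summation by parts: multiplication by \<open>1 - z\<close> turns the coefficients into
  their increments, which are nonnegative and add up to at most \<open>c n\<close>.\<close>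

lemma norm_abel_sum_le:
  fixes c :: "nat \<Rightarrow> real" and z :: complex
  assumes mono: "\<And>m. c m \<le> c (Suc m)" and c0: "c 0 \<ge> 0" and z: "norm z = 1"
  shows "norm ((1 - z) * (\<Sum>m=1..n. of_real (c m) * z ^ m)) \<le> 2 * c n"
proof -
  \<comment> \<open>With the boundary term \<open>c n * z ^ Suc n\<close> added, the induction
    passes from \<open>n\<close> to \<open>Suc n\<close> by a single increment of \<open>c\<close>;
    taking that term off again costs the second \<open>c n\<close>.\<close>
  have *: "norm ((1 - z) * (\<Sum>m=1..n. of_real (c m) * z ^ m) + of_real (c n) * z ^ Suc n) \<le> c n" for n
  proof (induction n)
    case 0
    then show ?case using c0 z by (simp add: norm_mult)
  next
    case (Suc n)
    have "(1 - z) * (\<Sum>m=1..Suc n. of_real (c m) * z ^ m) + of_real (c (Suc n)) * z ^ Suc (Suc n)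
       = ((1 - z) * (\<Sum>m=1..n. of_real (c m) * z ^ m) + of_real (c n) * z ^ Suc n)
         + of_real (c (Suc n) - c n) * z ^ Suc n"
      by (simp add: algebra_simps)
    also have "norm \<dots> \<le> c n + (c (Suc n) - c n)"
    proof (rule norm_triangle_le[OF add_mono[OF Suc]])
      show "norm (of_real (c (Suc n) - c n) * z ^ Suc n) \<le> c (Suc n) - c n"
        using mono[of n] z by (simp add: norm_mult norm_power del: of_real_diff)
    qed
    finally show ?case by simp
  qed
  have "norm (of_real (c n) * z ^ Suc n) = \<bar>c n\<bar>"
    using z by (simp add: norm_mult norm_power)
  moreover have "0 \<le> c n"
    using *[of n] norm_ge_zero order_trans by blast
  ultimately show ?thesis
    using *[of n] norm_triangle_ineq4[of "(1 - z) * (\<Sum>m=1..n. of_real (c m) * z ^ m) + of_real (c n) * z ^ Suc n" "of_real (c n) * z ^ Suc n"]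
    by simp
qed

text \<open>Samples of the monomial \<open>x ^ q\<close> on \<open>(0, R]\<close> at mesh
  \<open>1 / a\<close>, with the weight \<open>1 / a\<close> of a Riemann sum, so that the total
  mass stays bounded as \<open>a\<close> grows.\<close>

definition mono_kernel :: "nat \<Rightarrow> nat \<Rightarrow> nat \<Rightarrow> int \<Rightarrow> real" where
  "mono_kernel R q a m = (if 1 \<le> m \<and> m \<le> int (R * a) then (of_int m / real a) ^ q / real a else 0)"

definition box_kernel :: "nat \<Rightarrow> int \<Rightarrow> real" where
  "box_kernel a m = (if \<bar>m\<bar> \<le> int a then 1 / (2 * real a + 1) else 0)"

lemma sum_mono_kernel:
  fixes f :: "int \<Rightarrow> 'b::{real_algebra_1}"
  assumes "int (R * a) \<le> L"
  shows "(\<Sum>m\<in>{-L..L}. of_real (mono_kernel R q a m) * f m)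
       = (\<Sum>m=1..R*a. of_real ((real m / real a) ^ q / real a) * f (int m))"
proof -
  have "(\<Sum>m\<in>{-L..L}. of_real (mono_kernel R q a m) * f m)
      = (\<Sum>m\<in>int ` {1..R*a}. of_real (mono_kernel R q a m) * f m)"
  proof (rule sum.mono_neutral_right)
    have "int m \<le> L" if "m \<le> R * a" for m
      using that assms order_trans zle_int by blast
    then show "int ` {1..R*a} \<subseteq> {-L..L}" by fastforce
    show "\<forall>m\<in>{-L..L} - int ` {1..R*a}. of_real (mono_kernel R q a m) * f m = 0"
    proof
      fix m assume m: "m \<in> {-L..L} - int ` {1..R*a}"
      have "\<not> (1 \<le> m \<and> m \<le> int (R * a))"
      proof
        assume "1 \<le> m \<and> m \<le> int (R * a)"
        then have "m = int (nat m)" "nat m \<in> {1..R*a}" by (auto simp: nat_le_iff)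
        then show False using m by blast
      qed
      then show "of_real (mono_kernel R q a m) * f m = 0"
        by (auto simp: mono_kernel_def)
    qed
  qed simp
  also have "\<dots> = (\<Sum>m=1..R*a. of_real (mono_kernel R q a (int m)) * f (int m))"
    by (subst sum.reindex) auto
  also have "\<dots> = (\<Sum>m=1..R*a. of_real ((real m / real a) ^ q / real a) * f (int m))"
    by (intro sum.cong) (auto simp: mono_kernel_def simp flip: of_nat_mult)
  finally show ?thesis .
qed

text \<open>Decay comes from summation by parts, since the coefficients increase up to the cutoff
  \<open>R * a\<close>. The constant is free of \<open>a\<close>; \<open>R \<ge> 2\<close> absorbs
  the factor 2 that summation by parts costs.\<close>

lemma adapted_mono_kernel:
  assumes a: "a \<ge> 1" and R: "R \<ge> 2" and L: "int (R * a) \<le> L"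
  shows "adapted (real R ^ (q + 2)) a (trig {-L..L} (mono_kernel R q a))"
  unfolding adapted_def
proof (intro allI impI)
  fix z :: complex assume z: "norm z = 1"
  let ?u = "trig {-L..L} (mono_kernel R q a)"
  have "(\<Sum>m\<in>{-L..L}. \<bar>mono_kernel R q a m\<bar>) = (\<Sum>m\<in>{-L..L}. of_real (mono_kernel R q a m) * 1)"
    by (intro sum.cong) (auto simp: mono_kernel_def)
  also have "\<dots> = (\<Sum>m=1..R*a. of_real ((real m / real a) ^ q / real a) * 1)"
    by (rule sum_mono_kernel[OF L])
  also have "\<dots> \<le> (\<Sum>m=1..R*a. real R ^ q / real a)"
  proof (intro sum_mono)
    fix m assume m: "m \<in> {1..R*a}"
    then have "real m \<le> real R * real a" by (simp flip: of_nat_mult)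
    then have "real m / real a \<le> real R" using a by (simp add: field_simps)
    then show "of_real ((real m / real a) ^ q / real a) * 1 \<le> real R ^ q / real a"
      by (simp add: divide_right_mono power_mono)
  qed
  also have "\<dots> = real R ^ (q + 1)" using a by simp
  finally have S: "(\<Sum>m\<in>{-L..L}. \<bar>mono_kernel R q a m\<bar>) \<le> real R ^ (q + 1)" .
  have R1: "real R ^ (q + 1) \<le> real R ^ (q + 2)" using R by (intro power_increasing) auto
  have "norm (?u z) \<le> real R ^ (q + 2)"
    using norm_trig_le[OF z, of "{-L..L}" "mono_kernel R q a"] S R1 by linarith
  moreover have "real a * norm (1 - z) * norm (?u z) \<le> real R ^ (q + 2)"
  proof -
    have "?u z = (\<Sum>m=1..R*a. of_real ((real m / real a) ^ q / real a) * z ^ m)"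
      unfolding trig_def by (subst sum_mono_kernel[OF L]) simp
    then have "norm ((1 - z) * ?u z) \<le> 2 * ((real (R * a) / real a) ^ q / real a)"
      by (simp only:) (rule norm_abel_sum_le, use z in \<open>auto intro!: divide_right_mono power_mono\<close>)
    then have "real a * norm ((1 - z) * ?u z) \<le> real a * (2 * (real R ^ q / real a))"
      using a by (intro mult_left_mono) auto
    also have "\<dots> = 2 * real R ^ q" using a by simp
    also have "\<dots> \<le> real R * (real R * real R ^ q)"
      using R by (simp add: mult.assoc[symmetric] mult_right_mono) (use mult_mono[of 1 "real R" 2 "real R"] in auto)
    finally show ?thesis by (simp add: norm_mult mult.assoc)
  qed
  moreover have "norm (?u z - ?u 1) \<le> real R ^ (q + 2) * (real a * norm (1 - z))"
  proof -
    have "norm (?u z - ?u 1) \<le> (\<Sum>m\<in>{-L..L}. \<bar>mono_kernel R q a m\<bar>) * (real (R * a) * norm (1 - z))"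
      by (rule norm_trig_diff_le[OF z]) (auto simp: mono_kernel_def split: if_splits simp flip: of_nat_mult)
    also have "\<dots> \<le> real R ^ (q + 1) * (real (R * a) * norm (1 - z))"
      using S by (intro mult_right_mono) auto
    finally show ?thesis by (simp add: algebra_simps)
  qed
  ultimately show "norm (?u z) \<le> real R ^ (q + 2) \<and> real a * norm (1 - z) * norm (?u z) \<le> real R ^ (q + 2) \<and>
      norm (?u z - ?u 1) \<le> real R ^ (q + 2) * (real a * norm (1 - z))" by blast
qed

lemma sum_box_kernel:
  fixes f :: "int \<Rightarrow> 'b::{real_algebra_1}"
  assumes "int a \<le> L"
  shows "(\<Sum>m\<in>{-L..L}. of_real (box_kernel a m) * f m)
       = of_real (1 / (2 * real a + 1)) * (\<Sum>m\<in>{- int a..int a}. f m)"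
proof -
  have "(\<Sum>m\<in>{-L..L}. of_real (box_kernel a m) * f m) = (\<Sum>m\<in>{- int a..int a}. of_real (box_kernel a m) * f m)"
    using assms by (intro sum.mono_neutral_right) (auto simp: box_kernel_def)
  also have "\<dots> = (\<Sum>m\<in>{- int a..int a}. of_real (1 / (2 * real a + 1)) * f m)"
    by (intro sum.cong) (auto simp: box_kernel_def)
  finally show ?thesis by (simp add: sum_distrib_left)
qed

lemma trig_box_kernel_one:
  assumes "int a \<le> L"
  shows "trig {-L..L} (box_kernel a) 1 = 1"
proof -
  have "trig {-L..L} (box_kernel a) 1 = of_real (1 / (2 * real a + 1)) * of_real (2 * real a + 1)"
    unfolding trig_def by (subst sum_box_kernel[OF assms]) simp
  also have "\<dots> = of_real (1 / (2 * real a + 1) * (2 * real a + 1))"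
    by (simp only: of_real_mult)
  also have "1 / (2 * real a + 1) * (2 * real a + 1) = 1"
    by simp
  finally show ?thesis by simp
qed

text \<open>The transform is a normalised Dirichlet kernel, so its decay follows from the closed
  form of a geometric sum.\<close>

lemma adapted_box_kernel:
  assumes L: "int a \<le> L"
  shows "adapted 1 a (trig {-L..L} (box_kernel a))"
  unfolding adapted_def
proof (intro allI impI)
  fix z :: complex assume z: "norm z = 1"
  let ?u = "trig {-L..L} (box_kernel a)"
  have z0: "z \<noteq> 0" using z by auto
  have "(\<Sum>m\<in>{-L..L}. \<bar>box_kernel a m\<bar>) = (\<Sum>m\<in>{-L..L}. of_real (box_kernel a m) * 1)"
    by (intro sum.cong) (auto simp: box_kernel_def)
  also have "\<dots> = 1"
    by (subst sum_box_kernel[OF L]) simp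
  finally have S: "(\<Sum>m\<in>{-L..L}. \<bar>box_kernel a m\<bar>) = 1" .
  have "norm (?u z) \<le> 1"
    using norm_trig_le[OF z, of "{-L..L}" "box_kernel a"] S by simp
  moreover have "real a * norm (1 - z) * norm (?u z) \<le> 1"
  proof -
    \<comment> \<open>The symmetric sum gains both endpoints at once, so each induction step
      telescopes at either end.\<close>
    have geo: "(1 - z) * (\<Sum>m\<in>{- int n..int n}. z powi m) = z powi (- int n) - z powi (int n + 1)" for n
    proof (induction n)
      case 0
      then show ?case by simp
    next
      case (Suc n)
      have "{- int (Suc n)..int (Suc n)} = insert (- int (Suc n)) (insert (int (Suc n)) {- int n..int n})"
        by auto
      then have "(\<Sum>m\<in>{- int (Suc n)..int (Suc n)}. z powi m)
          = z powi (- int (Suc n)) + (z powi (int (Suc n)) + (\<Sum>m\<in>{- int n..int n}. z powi m))"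
        by simp
      then have "(1 - z) * (\<Sum>m\<in>{- int (Suc n)..int (Suc n)}. z powi m)
          = z powi (- int (Suc n)) - z * z powi (- int (Suc n)) + z powi (int (Suc n)) - z * z powi (int (Suc n))
            + (z powi (- int n) - z powi (int n + 1))"
        using Suc by (simp add: algebra_simps)
      moreover have "z * z powi (- int (Suc n)) = z powi (- int n)"
        using power_int_add_1'[of z "- int (Suc n)"] z0 by simp
      moreover have "z * z powi (int (Suc n)) = z powi (int (Suc n) + 1)"
        using power_int_add_1'[of z "int (Suc n)"] z0 by simp
      ultimately show ?case by (simp add: add.commute)
    qed
    have "norm ((1 - z) * (\<Sum>m\<in>{- int a..int a}. z powi m)) \<le> 2"
      unfolding geo using norm_triangle_ineq4[of "z powi (- int a)" "z powi (int a + 1)"] z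
      by (simp add: norm_power_int)
    moreover have "?u z = of_real (1 / (2 * real a + 1)) * (\<Sum>m\<in>{- int a..int a}. z powi m)"
      unfolding trig_def by (rule sum_box_kernel[OF L])
    ultimately have "(2 * real a + 1) * (norm (1 - z) * norm (?u z)) \<le> 2"
      by (simp add: norm_mult norm_divide del: of_real_divide of_real_add)
    then have "2 * (real a * (norm (1 - z) * norm (?u z))) + norm (1 - z) * norm (?u z) \<le> 2"
      by (simp add: algebra_simps)
    moreover have "0 \<le> norm (1 - z) * norm (?u z)" by simp
    ultimately show ?thesis unfolding mult.assoc by linarith
  qed
  moreover have "norm (?u z - ?u 1) \<le> 1 * (real a * norm (1 - z))"
    using norm_trig_diff_le[OF z, of "{-L..L}" "box_kernel a" "real a"] S
    by (auto simp: box_kernel_def split: if_splits)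
  ultimately show "norm (?u z) \<le> 1 \<and> real a * norm (1 - z) * norm (?u z) \<le> 1 \<and>
      norm (?u z - ?u 1) \<le> 1 * (real a * norm (1 - z))" by blast
qed

section \<open>Summation of mean-zero kernels over all scales\<close>

text \<open>Bounds \<open>min t (1 / t)\<close> by an increment of the bounded increasing function \<open>t / (1 + t)\<close>, so that
  sums along geometric sequences \<open>t\<close> telescope.\<close>
lemma min_le_telescope:
  fixes d E t q :: real
  assumes "0 \<le> t" "2 \<le> q" "0 \<le> E" "d \<le> E * t" "t * d \<le> E"
  shows "d \<le> 6 * E * (q * t / (1 + q * t) - t / (1 + t))"
proof -
  have qt: "0 < 1 + q * t" "0 < 1 + t"
    using assms by (auto simp: add_pos_nonneg)
  have eq: "q * t / (1 + q * t) - t / (1 + t) = (q - 1) * t / ((1 + q * t) * (1 + t))"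
    using qt by (simp add: field_simps)
  show ?thesis
  proof (cases "t \<le> 1")
    case True
    have "(1 + q * t) * (1 + t) \<le> (1 + q) * 2"
      using assms True by (intro mult_mono add_mono mult_left_le) auto
    \<comment> \<open>This holds exactly when \<open>q \<ge> 2\<close>; it fixes the constant 6 in
      both cases.\<close>
    also have "\<dots> \<le> 6 * (q - 1)" using assms by simp
    finally have "t * ((1 + q * t) * (1 + t)) \<le> t * (6 * (q - 1))"
      using assms by (intro mult_left_mono)
    then have "t \<le> 6 * ((q - 1) * t / ((1 + q * t) * (1 + t)))"
      using qt by (simp add: pos_le_divide_eq mult_ac)
    then have "E * t \<le> E * (6 * ((q - 1) * t / ((1 + q * t) * (1 + t))))"
      using assms by (intro mult_left_mono)
    then show ?thesis unfolding eq using assms by (simp add: mult_ac)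
  next
    case False
    have "(1 + q * t) * (1 + t) \<le> ((1 + q) * t) * (2 * t)"
      using assms False by (intro mult_mono) (auto simp: algebra_simps)
    also have "\<dots> \<le> 6 * (q - 1) * (t * t)"
      using assms mult_right_mono[of "(1 + q) * 2" "6 * (q - 1)" "t * t"] by (simp add: mult_ac)
    finally have "(1 + q * t) * (1 + t) \<le> 6 * (q - 1) * (t * t)" .
    then have "1 \<le> 6 * (q - 1) * (t * t) / ((1 + q * t) * (1 + t))"
      using qt by (subst pos_le_divide_eq) auto
    then have "1 / t \<le> 6 * ((q - 1) * t / ((1 + q * t) * (1 + t)))"
      using False by (simp add: pos_divide_le_eq mult_ac)
    then have "E * (1 / t) \<le> E * (6 * ((q - 1) * t / ((1 + q * t) * (1 + t))))"
      using assms by (intro mult_left_mono)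
    moreover have "d \<le> E * (1 / t)" using assms False by (simp add: field_simps)
    ultimately show ?thesis unfolding eq by (simp add: mult_ac)
  qed
qed

lemma adapted_mono:
  assumes "adapted C a u" "C \<le> C'" "0 \<le> a"
  shows "adapted C' a u"
  using assms unfolding adapted_def
  by (meson mult_right_mono mult_nonneg_nonneg norm_ge_zero order_trans)

text \<open>\<open>u z * v w\<close> is the transform of a tensor kernel of mass
  \<open>u 1 * v 1\<close>, and \<open>u' z * v' w\<close> that of a kernel of mass 1, so the
  difference vanishes at \<open>(1, 1)\<close>. This makes it small near that point, while decay in
  each variable is inherited from the factors. At most four factors of size \<open>C\<close> occur,
  hence \<open>C ^ 4\<close>.\<close>

lemma mean_zero_tensor_bounds:
  assumes u: "adapted C a u" "adapted C a u'" and v: "adapted C b v" "adapted C b v'"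
    and one: "u' 1 = 1" "v' 1 = 1" and C: "C \<ge> 1" and ab: "0 \<le> a" "0 \<le> b"
    and z: "norm z = 1" and w: "norm w = 1"
  defines "D \<equiv> norm (u z * v w - u 1 * v 1 * (u' z * v' w))"
  shows "D \<le> 2 * C ^ 4 * (a * norm (1 - z) + b * norm (1 - w))"
    and "a * norm (1 - z) * D \<le> 2 * C ^ 4" and "b * norm (1 - w) * D \<le> 2 * C ^ 4"
proof -
  let ?t = "a * norm (1 - z)" and ?s = "b * norm (1 - w)"
  have t0: "0 \<le> ?t" "0 \<le> ?s" using ab by auto
  have C0: "0 \<le> C" using C by simp
  have C24: "C ^ 2 \<le> C ^ 4" using C by (intro power_increasing) auto
  have C34: "C ^ 3 \<le> C ^ 4" using C by (intro power_increasing) auto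
  have bu: "norm (u z) \<le> C" "?t * norm (u z) \<le> C" "norm (u z - u 1) \<le> C * ?t" "norm (u 1) \<le> C"
    and bu': "norm (u' z) \<le> C" "?t * norm (u' z) \<le> C" "norm (u' z - 1) \<le> C * ?t"
    using u z one by (auto simp: adapted_def)
  have bv: "norm (v w) \<le> C" "?s * norm (v w) \<le> C" "norm (v w - v 1) \<le> C * ?s" "norm (v 1) \<le> C"
    and bv': "norm (v' w) \<le> C" "?s * norm (v' w) \<le> C" "norm (v' w - 1) \<le> C * ?s"
    using v w one by (auto simp: adapted_def)
  have D_le: "D \<le> norm (u z) * norm (v w) + norm (u 1) * norm (v 1) * (norm (u' z) * norm (v' w))"
    unfolding D_def using norm_triangle_ineq4[of "u z * v w" "u 1 * v 1 * (u' z * v' w)"]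
    by (simp add: norm_mult)
  have "?t * D \<le> (?t * norm (u z)) * norm (v w) + norm (u 1) * norm (v 1) * ((?t * norm (u' z)) * norm (v' w))"
    using mult_left_mono[OF D_le t0(1)] by (simp add: algebra_simps)
  also have "\<dots> \<le> C * C + C * C * (C * C)"
    using bu bu' bv bv' t0 C0 ab by (intro add_mono mult_mono mult_nonneg_nonneg) auto
  finally show "?t * D \<le> 2 * C ^ 4"
    using C24 by (simp add: power2_eq_square power4_eq_xxxx mult_ac)
  have "?s * D \<le> norm (u z) * (?s * norm (v w)) + norm (u 1) * norm (v 1) * (norm (u' z) * (?s * norm (v' w)))"
    using mult_left_mono[OF D_le t0(2)] by (simp add: algebra_simps)
  also have "\<dots> \<le> C * C + C * C * (C * C)"
    using bu bu' bv bv' t0 C0 ab by (intro add_mono mult_mono mult_nonneg_nonneg) auto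
  finally show "?s * D \<le> 2 * C ^ 4"
    using C24 by (simp add: power2_eq_square power4_eq_xxxx mult_ac)
  \<comment> \<open>A splitting in which each term carries exactly one difference from a value at 1,
    using \<open>u' 1 = 1\<close> and \<open>v' 1 = 1\<close>.\<close>
  have "u z * v w - u 1 * v 1 * (u' z * v' w)
      = (u z - u 1) * v w + u 1 * (v w - v 1) - u 1 * v 1 * ((u' z - 1) * v' w + (v' w - 1))"
    by (simp add: algebra_simps)
  then have "D \<le> norm (u z - u 1) * norm (v w) + norm (u 1) * norm (v w - v 1)
      + norm (u 1) * norm (v 1) * (norm (u' z - 1) * norm (v' w) + norm (v' w - 1))"
    unfolding D_def
    by (simp only:) (intro norm_triangle_le_diff norm_triangle_le add_mono mult_left_mono order_refl
         mult_nonneg_nonneg norm_ge_zero eq_refl[OF norm_mult]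
         order_trans[OF eq_refl[OF norm_mult[of "u 1 * v 1"]]]
         | simp add: norm_mult)+
  also have "\<dots> \<le> (C * ?t) * C + C * (C * ?s) + C * C * ((C * ?t) * C + C * ?s)"
    using bu bu' bv bv' t0 C0 by (intro add_mono mult_mono mult_nonneg_nonneg add_nonneg_nonneg) (use ab in auto)
  also have "\<dots> = (C ^ 2 + C ^ 4) * ?t + (C ^ 2 + C ^ 3) * ?s"
    by (simp add: algebra_simps power2_eq_square power4_eq_xxxx power3_eq_cube)
  also have "\<dots> \<le> (2 * C ^ 4) * ?t + (2 * C ^ 4) * ?s"
    using C24 C34 t0 by (intro add_mono mult_right_mono) auto
  finally show "D \<le> 2 * C ^ 4 * (?t + ?s)" by (simp add: algebra_simps)
qed

text \<open>Each summand is at most a constant times \<open>min \<tau> (1 / \<tau>)\<close>, where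
  \<open>\<tau>\<close> is the larger of \<open>a s * norm (1 - z)\<close> and
  \<open>b s * norm (1 - w)\<close>. Both grow geometrically in \<open>s\<close>, so the sum is
  bounded independently of the number \<open>S\<close> of scales.\<close>

lemma mean_zero_tensor_sum_bounded:
  fixes a b :: "nat \<Rightarrow> real"
  assumes "\<And>s. s < S \<Longrightarrow> adapted C (a s) (u s)" "\<And>s. s < S \<Longrightarrow> adapted C (a s) (u' s)"
    and "\<And>s. s < S \<Longrightarrow> adapted C (b s) (v s)" "\<And>s. s < S \<Longrightarrow> adapted C (b s) (v' s)"
    and "\<And>s. s < S \<Longrightarrow> u' s 1 = 1" "\<And>s. s < S \<Longrightarrow> v' s 1 = 1" and C: "C \<ge> 1"
    and a: "\<And>s. 0 \<le> a s" "\<And>s. a (Suc s) = p * a s" "p \<ge> 2"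
    and b: "\<And>s. 0 \<le> b s" "\<And>s. b (Suc s) = q * b s" "q \<ge> 2"
    and z: "norm z = 1" and w: "norm w = 1"
  shows "norm (\<Sum>s<S. u s z * v s w - u s 1 * v s 1 * (u' s z * v' s w)) \<le> 48 * C ^ 4"
proof -
  \<comment> \<open>The 4 in place of 2 pays for bounding the sum of the two scaled distances by
    twice the larger one.\<close>
  define E where "E = 4 * C ^ 4"
  define \<Theta> :: "real \<Rightarrow> real" where "\<Theta> t = t / (1 + t)" for t
  let ?t = "\<lambda>s. a s * norm (1 - z)" and ?r = "\<lambda>s. b s * norm (1 - w)"
  have E: "E \<ge> 0" using C by (simp add: E_def)
  have t0: "0 \<le> ?t s" "0 \<le> ?r s" for s using a b by auto
  have \<Theta>_mono: "\<Theta> x \<le> \<Theta> (c * x)" if "0 \<le> x" "c \<ge> 2" for x c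
  proof -
    have "x \<le> c * x" using that mult_right_mono[of 1 c x] by simp
    then show ?thesis using that by (auto simp: \<Theta>_def field_simps)
  qed
  have \<Theta>_1: "0 \<le> \<Theta> x" "\<Theta> x \<le> 1" if "0 \<le> x" for x using that by (auto simp: \<Theta>_def)
  have "norm (u s z * v s w - u s 1 * v s 1 * (u' s z * v' s w))
      \<le> 6 * E * (\<Theta> (?t (Suc s)) - \<Theta> (?t s)) + 6 * E * (\<Theta> (?r (Suc s)) - \<Theta> (?r s))" if s: "s < S" for s
  proof -
    let ?D = "norm (u s z * v s w - u s 1 * v s 1 * (u' s z * v' s w))"
    note bd = mean_zero_tensor_bounds[OF assms(1)[OF s] assms(2)[OF s] assms(3)[OF s] assms(4)[OF s]
       assms(5)[OF s] assms(6)[OF s] C a(1)[of s] b(1)[of s] z w]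
    have st: "?t (Suc s) = p * ?t s" "?r (Suc s) = q * ?r s" using a b by auto
    have nn: "0 \<le> 6 * E * (\<Theta> (?t (Suc s)) - \<Theta> (?t s))" "0 \<le> 6 * E * (\<Theta> (?r (Suc s)) - \<Theta> (?r s))"
      unfolding st using E \<Theta>_mono[OF t0(1) a(3), of s] \<Theta>_mono[OF t0(2) b(3), of s] by (auto)
    have C4: "0 \<le> 2 * C ^ 4" using C by simp
    \<comment> \<open>The larger scaled distance controls the summand through its own increment of
      \<open>\<Theta>\<close>. The other increment is nonnegative and is added at no cost, so both
      cases end in the same telescoping bound.\<close>
    show ?thesis
    proof (cases "?r s \<le> ?t s")
      case True
      have "?D \<le> E * ?t s"
        using bd(1) mult_left_mono[OF True C4] by (simp add: E_def algebra_simps)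
      moreover have "?t s * ?D \<le> E" using bd(2) C4 unfolding E_def by linarith
      ultimately have "?D \<le> 6 * E * (\<Theta> (p * ?t s) - \<Theta> (?t s))"
        unfolding \<Theta>_def by (intro min_le_telescope t0 a E)
      then show ?thesis using nn unfolding st by linarith
    next
      case False
      have "?D \<le> E * ?r s"
        using bd(1) mult_left_mono[of "?t s" "?r s", OF _ C4] False by (simp add: E_def algebra_simps)
      moreover have "?r s * ?D \<le> E" using bd(3) C4 unfolding E_def by linarith
      ultimately have "?D \<le> 6 * E * (\<Theta> (q * ?r s) - \<Theta> (?r s))"
        unfolding \<Theta>_def by (intro min_le_telescope t0 b E)
      then show ?thesis using nn unfolding st by linarith
    qed
  qed
  then have "norm (\<Sum>s<S. u s z * v s w - u s 1 * v s 1 * (u' s z * v' s w))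
      \<le> (\<Sum>s<S. 6 * E * (\<Theta> (?t (Suc s)) - \<Theta> (?t s)) + 6 * E * (\<Theta> (?r (Suc s)) - \<Theta> (?r s)))"
    by (intro sum_norm_le) auto
  also have "\<dots> = 6 * E * (\<Theta> (?t S) - \<Theta> (?t 0)) + 6 * E * (\<Theta> (?r S) - \<Theta> (?r 0))"
    using sum_lessThan_telescope[of "\<lambda>s. \<Theta> (?t s)" S] sum_lessThan_telescope[of "\<lambda>s. \<Theta> (?r s)" S]
    by (simp add: sum.distrib flip: sum_distrib_left)
  also have "\<dots> \<le> 6 * E * 1 + 6 * E * 1"
    using E \<Theta>_1[OF t0(1), of S] \<Theta>_1[OF t0(1), of 0] \<Theta>_1[OF t0(2), of S] \<Theta>_1[OF t0(2), of 0]
    by (intro add_mono mult_left_mono) auto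
  finally show ?thesis by (simp add: E_def)
qed

subsection \<open>Positive definiteness of the moment matrices\<close>

text \<open>Quantitative invertibility of the Vandermonde matrix at distinct nodes: Lagrange
  interpolation writes the coefficients as fixed linear combinations of the values.\<close>

lemma poly_coeffs_bounded_by_values:
  fixes x :: "nat \<Rightarrow> real"
  assumes inj: "inj_on x {..N}"
  shows "\<exists>c>0. \<forall>w :: nat \<Rightarrow> complex.
    c * (\<Sum>j\<le>N. (norm (w j))\<^sup>2) \<le> (\<Sum>q\<le>N. (norm (\<Sum>j\<le>N. of_real (x q ^ j) * w j))\<^sup>2)"
proof -
  define X where "X q = complex_of_real (x q)" for q
  \<comment> \<open>The Lagrange basis polynomial of the node \<open>X q\<close>.\<close>
  define \<l> where "\<l> q = (\<Prod>p\<in>{..N} - {q}. smult (1 / (X q - X p)) [:- X p, 1:])" for q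
  have Xinj: "X q = X p \<longleftrightarrow> q = p" if "q \<le> N" "p \<le> N" for q p
    using inj that by (auto simp: X_def inj_on_def)
  have deg_l: "degree (\<l> q) \<le> N" if "q \<le> N" for q
  proof -
    have "degree (\<l> q) \<le> (\<Sum>p\<in>{..N} - {q}. degree (smult (1 / (X q - X p)) [:- X p, 1:]))"
      unfolding \<l>_def by (rule order_trans[OF degree_prod_sum_le]) (auto simp: o_def)
    also have "\<dots> \<le> (\<Sum>p\<in>{..N} - {q}. 1)"
      by (intro sum_mono) auto
    finally show ?thesis using that by simp
  qed
  have val_l: "poly (\<l> q) (X p) = (if p = q then 1 else 0)" if "q \<le> N" "p \<le> N" for p q
  proof (cases "p = q")
    case True
    have "poly (\<l> q) (X q) = 1"
      unfolding \<l>_def poly_prod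
    proof (rule prod.neutral, rule ballI)
      fix r assume "r \<in> {..N} - {q}"
      then have "X q - X r \<noteq> 0" using Xinj[of q r] that by auto
      then show "poly (smult (1 / (X q - X r)) [:- X r, 1:]) (X q) = 1"
        by (simp add: diff_divide_distrib[symmetric])
    qed
    then show ?thesis using True by simp
  next
    case False
    then show ?thesis using that by (auto simp: \<l>_def poly_prod)
  qed
  define B where "B = (\<Sum>j\<le>N. \<Sum>q\<le>N. norm (coeff (\<l> q) j))"
  have coef_le: "norm (coeff (\<l> q) j) \<le> B" if "q \<le> N" "j \<le> N" for q j
  proof -
    have "norm (coeff (\<l> q) j) \<le> (\<Sum>q\<le>N. norm (coeff (\<l> q) j))"
      using that by (intro member_le_sum) auto
    also have "\<dots> \<le> B"
      unfolding B_def using that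
      by (intro member_le_sum[where f = "\<lambda>j. \<Sum>q\<le>N. norm (coeff (\<l> q) j)"]) (auto intro: sum_nonneg)
    finally show ?thesis .
  qed
  \<comment> \<open>The 1 added to \<open>B\<^sup>2\<close> makes the constant visibly positive, so
    that its inverse can serve as \<open>c\<close>. One factor \<open>real N + 1\<close> comes from
    Cauchy-Schwarz, the other from summing over \<open>j\<close>.\<close>
  have key: "(\<Sum>j\<le>N. (norm (w j))\<^sup>2) \<le> (real N + 1)\<^sup>2 * (B\<^sup>2 + 1) * (\<Sum>q\<le>N. (norm (\<Sum>j\<le>N. of_real (x q ^ j) * w j))\<^sup>2)"
    for w :: "nat \<Rightarrow> complex"
  proof -
    define P where "P = (\<Sum>j\<le>N. monom (w j) j)"
    define V where "V q = (\<Sum>j\<le>N. of_real (x q ^ j) * w j)" for q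
    have PV: "poly P (X q) = V q" for q
      by (simp add: P_def V_def X_def poly_sum poly_monom mult.commute)
    have degP: "degree P \<le> N" unfolding P_def
      by (intro degree_sum_le) (auto intro: order_trans[OF degree_monom_le])
    \<comment> \<open>Both sides have degree at most \<open>N\<close> and agree at
      \<open>N + 1\<close> nodes.\<close>
    have Peq: "P = (\<Sum>q\<le>N. smult (V q) (\<l> q))"
    proof (rule poly_eqI_degree[of "X ` {..N}"])
      fix y assume "y \<in> X ` {..N}"
      then obtain p where p: "p \<le> N" "y = X p" by auto
      then show "poly P y = poly (\<Sum>q\<le>N. smult (V q) (\<l> q)) y"
        using val_l by (simp add: PV poly_sum if_distrib[of "\<lambda>t. _ * t"] cong: if_cong)
    next
      have card: "card (X ` {..N}) = Suc N"
        using Xinj by (subst card_image) (auto simp: inj_on_def)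
      show "degree P < card (X ` {..N})" using degP card by simp
      have "degree (\<Sum>q\<le>N. smult (V q) (\<l> q)) \<le> N"
        by (intro degree_sum_le) (auto intro: order_trans[OF degree_smult_le] deg_l)
      then show "degree (\<Sum>q\<le>N. smult (V q) (\<l> q)) < card (X ` {..N})" using card by simp
    qed
    have wj: "w j = (\<Sum>q\<le>N. V q * coeff (\<l> q) j)" if "j \<le> N" for j
    proof -
      have "coeff P j = w j" using that by (simp add: P_def coeff_sum)
      moreover have "coeff P j = (\<Sum>q\<le>N. V q * coeff (\<l> q) j)"
        by (subst Peq) (simp add: coeff_sum)
      ultimately show ?thesis by simp
    qed
    have "(norm (w j))\<^sup>2 \<le> (real N + 1) * (B\<^sup>2 + 1) * (\<Sum>q\<le>N. (norm (V q))\<^sup>2)" if "j \<le> N" for j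
    proof -
      have "norm (w j) \<le> (\<Sum>q\<le>N. norm (V q) * B)"
        unfolding wj[OF that] using that coef_le
        by (intro sum_norm_le) (auto simp: norm_mult intro: mult_left_mono)
      also have "\<dots> = B * (\<Sum>q\<le>N. norm (V q))" by (simp add: sum_distrib_left mult.commute)
      finally have "(norm (w j))\<^sup>2 \<le> (B * (\<Sum>q\<le>N. norm (V q)))\<^sup>2"
        by (intro power_mono) auto
      also have "\<dots> = B\<^sup>2 * (\<Sum>q\<le>N. norm (V q))\<^sup>2" by (simp add: power_mult_distrib)
      also have "\<dots> \<le> (B\<^sup>2 + 1) * ((\<Sum>q\<le>N. (norm (V q))\<^sup>2) * real (card {..N}))"
        by (intro mult_mono sum_squared_le_sum_of_squares) auto
      finally show ?thesis by (simp add: mult_ac add.commute)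
    qed
    then have "(\<Sum>j\<le>N. (norm (w j))\<^sup>2) \<le> (\<Sum>j\<le>N. (real N + 1) * (B\<^sup>2 + 1) * (\<Sum>q\<le>N. (norm (V q))\<^sup>2))"
      by (intro sum_mono) auto
    then show ?thesis by (simp add: V_def power2_eq_square mult_ac add.commute)
  qed
  have pos: "0 < (real N + 1)\<^sup>2 * (B\<^sup>2 + 1)" by (simp add: add_nonneg_pos)
  show ?thesis
    using pos key by (intro exI[of _ "1 / ((real N + 1)\<^sup>2 * (B\<^sup>2 + 1))"]) (auto simp: pos_divide_le_eq mult_ac)
qed

lemma norm_sum_square_expand:
  fixes g :: "nat \<Rightarrow> real" and z :: "nat \<Rightarrow> complex"
  shows "of_real ((norm (\<Sum>j\<le>N. of_real (g j) * z j))\<^sup>2)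
       = (\<Sum>i\<le>N. \<Sum>j\<le>N. of_real (g i * g j) * z i * cnj (z j))"
  by (simp only: complex_norm_square cnj_sum sum_product) (simp add: mult_ac)

text \<open>For \<open>m\<close> between \<open>a + 1\<close> and \<open>2 * a\<close> the dilates
  \<open>(q + 1) * m\<close>, \<open>q \<le> N\<close>, stay in the box, and along them the inner
  sum is a polynomial of degree at most \<open>N\<close> in \<open>(q + 1) ^ k\<close>, with
  distinct nodes. The largest dilate, \<open>2 * (N + 1) * a\<close>, explains \<open>R\<close>. The
  \<open>a * b\<close> starting points match the normalisation, which makes \<open>c\<close>
  independent of \<open>a\<close> and \<open>b\<close>.\<close>

lemma gram_lower_bound:
  fixes k l N :: nat
  assumes k: "k > 0"
  defines "R \<equiv> 2 * (N + 1)"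
  shows "\<exists>c>0. \<forall>(a::nat) (b::nat) (z :: nat \<Rightarrow> complex). a \<ge> 1 \<longrightarrow> b \<ge> 1 \<longrightarrow>
    c * (\<Sum>j\<le>N. (norm (z j))\<^sup>2) \<le> (\<Sum>m=1..R*a. \<Sum>n=1..R*b.
       (norm (\<Sum>j\<le>N. of_real ((real m / real a) ^ (k * j) * (real n / real b) ^ (l * (N - j))) * z j))\<^sup>2)
      / (real a * real b)"
proof -
  have "inj_on (\<lambda>q. real (q + 1) ^ k) {..N}"
    using k by (auto simp: inj_on_def power_eq_iff_eq_base)
  from poly_coeffs_bounded_by_values[OF this] obtain c where c: "c > 0" and
    cw: "\<And>w :: nat \<Rightarrow> complex. c * (\<Sum>j\<le>N. (norm (w j))\<^sup>2)
       \<le> (\<Sum>q\<le>N. (norm (\<Sum>j\<le>N. of_real ((real (q + 1) ^ k) ^ j) * w j))\<^sup>2)"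
    by blast
  have "c / real (N + 1) * (\<Sum>j\<le>N. (norm (z j))\<^sup>2) \<le> (\<Sum>m=1..R*a. \<Sum>n=1..R*b.
       (norm (\<Sum>j\<le>N. of_real ((real m / real a) ^ (k * j) * (real n / real b) ^ (l * (N - j))) * z j))\<^sup>2)
      / (real a * real b)" if a: "a \<ge> 1" and b: "b \<ge> 1" for a b and z :: "nat \<Rightarrow> complex"
  proof -
    define G where "G m n = (norm (\<Sum>j\<le>N. of_real ((real m / real a) ^ (k * j) * (real n / real b) ^ (l * (N - j))) * z j))\<^sup>2" for m n :: nat
    have G0: "G m n \<ge> 0" for m n by (simp add: G_def)
    \<comment> \<open>Since \<open>m / a\<close> and \<open>n / b\<close> are at least 1 here, the
      coefficients \<open>w j\<close> of that polynomial dominate the \<open>z j\<close> in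
      modulus.\<close>
    have 1: "c * (\<Sum>j\<le>N. (norm (z j))\<^sup>2) \<le> (\<Sum>q\<le>N. G ((q + 1) * m) n)"
      if m: "m \<in> {a+1..2*a}" and n: "n \<in> {b+1..2*b}" for m n
    proof -
      define w where "w j = of_real ((real m / real a) ^ (k * j) * (real n / real b) ^ (l * (N - j))) * z j" for j
      have "norm (z j) \<le> norm (w j)" for j
      proof -
        have "1 \<le> real m / real a" "1 \<le> real n / real b" using m n a b by auto
        then have "1 * 1 \<le> (real m / real a) ^ (k * j) * (real n / real b) ^ (l * (N - j))"
          by (intro mult_mono one_le_power) auto
        then have "1 * norm (z j) \<le> ((real m / real a) ^ (k * j) * (real n / real b) ^ (l * (N - j))) * norm (z j)"
          by (intro mult_right_mono) auto
        then show ?thesis by (simp add: w_def norm_mult norm_power norm_divide)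
      qed
      then have "c * (\<Sum>j\<le>N. (norm (z j))\<^sup>2) \<le> c * (\<Sum>j\<le>N. (norm (w j))\<^sup>2)"
        using c by (intro mult_left_mono sum_mono power_mono) auto
      also have "\<dots> \<le> (\<Sum>q\<le>N. (norm (\<Sum>j\<le>N. of_real ((real (q + 1) ^ k) ^ j) * w j))\<^sup>2)"
        by (rule cw)
      also have "\<dots> = (\<Sum>q\<le>N. G ((q + 1) * m) n)"
      proof (intro sum.cong refl)
        fix q
        have "of_real ((real (q + 1) ^ k) ^ j) * w j
           = of_real ((real ((q + 1) * m) / real a) ^ (k * j) * (real n / real b) ^ (l * (N - j))) * z j" for j
        proof -
          have "real ((q + 1) * m) / real a = real (q + 1) * (real m / real a)"
            by (simp only: of_nat_mult times_divide_eq_right)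
          then have "(real ((q + 1) * m) / real a) ^ (k * j) = (real (q + 1) ^ k) ^ j * (real m / real a) ^ (k * j)"
            by (simp only: power_mult_distrib power_mult)
          then show ?thesis
            by (simp only: w_def of_real_mult mult.assoc)
        qed
        then show "(norm (\<Sum>j\<le>N. of_real ((real (q + 1) ^ k) ^ j) * w j))\<^sup>2 = G ((q + 1) * m) n"
          unfolding G_def by (simp only:)
      qed
      finally show ?thesis .
    qed
    \<comment> \<open>Multiplication by \<open>q + 1\<close> is injective into
      \<open>{1..R*a}\<close>. Different \<open>q\<close> may hit the same point, which costs the
      factor \<open>N + 1\<close> below.\<close>
    have 2: "(\<Sum>m\<in>{a+1..2*a}. G ((q + 1) * m) n) \<le> (\<Sum>m=1..R*a. G m n)" if "q \<le> N" for q n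
    proof -
      have "(\<Sum>m\<in>{a+1..2*a}. G ((q + 1) * m) n) = (\<Sum>m\<in>(\<lambda>m. (q + 1) * m) ` {a+1..2*a}. G m n)"
        by (subst sum.reindex) (auto simp: inj_on_def simp del: mult_Suc)
      also have "\<dots> \<le> (\<Sum>m=1..R*a. G m n)"
      proof (intro sum_mono2)
        show "(\<lambda>m. (q + 1) * m) ` {a+1..2*a} \<subseteq> {1..R*a}"
        proof clarify
          fix m assume m: "m \<in> {a+1..2*a}"
          have "(q + 1) * m \<le> (N + 1) * (2 * a)" using m that by (intro mult_mono) auto
          moreover have "1 * 1 \<le> (q + 1) * m" using m by (intro mult_mono) auto
          ultimately show "(q + 1) * m \<in> {1..R*a}" by (simp add: R_def)
        qed
      qed (auto simp: G0)
      finally show ?thesis .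
    qed
    have "real a * real b * (c * (\<Sum>j\<le>N. (norm (z j))\<^sup>2))
        = (\<Sum>n\<in>{b+1..2*b}. \<Sum>m\<in>{a+1..2*a}. c * (\<Sum>j\<le>N. (norm (z j))\<^sup>2))"
      by (simp add: mult_ac)
    also have "\<dots> \<le> (\<Sum>n\<in>{b+1..2*b}. \<Sum>m\<in>{a+1..2*a}. \<Sum>q\<le>N. G ((q + 1) * m) n)"
      by (intro sum_mono 1)
    also have "\<dots> = (\<Sum>n\<in>{b+1..2*b}. \<Sum>q\<le>N. \<Sum>m\<in>{a+1..2*a}. G ((q + 1) * m) n)"
      by (intro sum.cong refl sum.swap)
    also have "\<dots> \<le> (\<Sum>n\<in>{b+1..2*b}. \<Sum>q\<le>N. \<Sum>m=1..R*a. G m n)"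
      by (intro sum_mono 2) auto
    also have "\<dots> \<le> (\<Sum>n=1..R*b. \<Sum>q\<le>N. \<Sum>m=1..R*a. G m n)"
    proof (intro sum_mono2)
      have "2 * b \<le> R * b" by (simp add: R_def)
      then show "{b+1..2*b} \<subseteq> {1..R*b}" by auto
    qed (use G0 in \<open>auto intro!: sum_nonneg simp del: sum_constant\<close>)
    also have "\<dots> = real (N + 1) * (\<Sum>n=1..R*b. \<Sum>m=1..R*a. G m n)"
      by (simp add: sum_distrib_left)
    also have "(\<Sum>n=1..R*b. \<Sum>m=1..R*a. G m n) = (\<Sum>m=1..R*a. \<Sum>n=1..R*b. G m n)"
      by (rule sum.swap)
    finally have 3: "real a * real b * (c * (\<Sum>j\<le>N. (norm (z j))\<^sup>2)) \<le> real (N + 1) * (\<Sum>m=1..R*a. \<Sum>n=1..R*b. G m n)" .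
    have N0: "real (N + 1) > 0" and ab0: "real a * real b > 0" using a b by auto
    have "c / real (N + 1) * (\<Sum>j\<le>N. (norm (z j))\<^sup>2)
       = real a * real b * (c * (\<Sum>j\<le>N. (norm (z j))\<^sup>2)) / (real (N + 1) * (real a * real b))"
      using a b by simp
    also have "\<dots> \<le> real (N + 1) * (\<Sum>m=1..R*a. \<Sum>n=1..R*b. G m n) / (real (N + 1) * (real a * real b))"
      using 3 N0 ab0 by (intro divide_right_mono) auto
    also have "\<dots> = (\<Sum>m=1..R*a. \<Sum>n=1..R*b. G m n) / (real a * real b)"
      using a b by simp
    finally show ?thesis unfolding G_def .
  qed
  then show ?thesis
    using c by (intro exI[of _ "c / real (N + 1)"]) auto
qed

subsection \<open>The bilinear estimate\<close>

text \<open>The property of \<open>f\<close> and \<open>g\<close> being Fourier coefficients of measures with product of norms at most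
  \<open>A\<close> that matters here: multipliers \<open>K\<close> with bounded Fourier transform act boundedly on \<open>f \<cdot> cnj g\<close>.\<close>
definition fourier_bound :: "(int \<times> int \<Rightarrow> complex) \<Rightarrow> (int \<times> int \<Rightarrow> complex) \<Rightarrow> real \<Rightarrow> bool" where
  "fourier_bound f g A \<longleftrightarrow> (\<forall>I (K :: int \<times> int \<Rightarrow> real) B. finite I \<longrightarrow>
     (\<forall>z w :: complex. norm z = 1 \<longrightarrow> norm w = 1 \<longrightarrow> norm (\<Sum>(m, n)\<in>I. of_real (K (m, n)) * (z powi m * w powi n)) \<le> B) \<longrightarrow>
     norm (\<Sum>p\<in>I. of_real (K p) * (f p * cnj (g p))) \<le> B * A)"

text \<open>The constant depends on \<open>k\<close>, \<open>l\<close> and \<open>N\<close> alone: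
  neither the number \<open>S\<close> of scales nor the finite set \<open>E\<close> enters, so both
  can be enlarged freely when infinite sums are formed. The integer weights in the relation between
  the \<open>M j\<close> make the kernels built from it real.\<close>

lemma frequency_estimate:
  assumes k: "k > 0" and l: "l > 0"
  shows "\<exists>C\<ge>0. \<forall>(M :: nat \<Rightarrow> int \<times> int \<Rightarrow> complex) A S E.
    (\<forall>i\<le>N. \<forall>j\<le>N. fourier_bound (M i) (M j) (A i * A j)) \<longrightarrow>
    (\<forall>m n. (\<Sum>j\<le>N. of_int (m ^ (k * j) * n ^ (l * (N - j))) * M j (m, n)) = 0) \<longrightarrow> finite E \<longrightarrow>
    (\<Sum>p\<in>E. \<Sum>s<S. box_kernel (2 ^ (l * s)) (fst p) * box_kernel (2 ^ (k * s)) (snd p) * (\<Sum>i\<le>N. (norm (M i p))\<^sup>2))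
      \<le> C * (\<Sum>i\<le>N. A i)\<^sup>2"
proof -
  define R where "R = 2 * (N + 1)"
  define a b where "a s = (2::nat) ^ (l * s)" and "b s = (2::nat) ^ (k * s)" for s
  \<comment> \<open>A common bound for the constants \<open>R ^ (q + 2)\<close> of the monomial
    kernels, whose exponents \<open>q\<close> are at most \<open>2 * k * N\<close> or
    \<open>2 * l * N\<close>.\<close>
  define C0 where "C0 = real R ^ (2 * k * N + 2 * l * N + 2)"
  obtain c where c: "c > 0" and gram: "\<And>a b z. a \<ge> 1 \<Longrightarrow> b \<ge> 1 \<Longrightarrow>
    c * (\<Sum>j\<le>N. (norm (z j))\<^sup>2) \<le> (\<Sum>m=1..R*a. \<Sum>n=1..R*b.
       (norm (\<Sum>j\<le>N. of_real ((real m / real a) ^ (k * j) * (real n / real b) ^ (l * (N - j))) * z j :: complex))\<^sup>2)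
      / (real a * real b)"
    using gram_lower_bound[OF k, of N l] unfolding R_def by blast
  have R2: "R \<ge> 2" by (simp add: R_def)
  have C0: "C0 \<ge> 1" unfolding C0_def using R2 by (intro one_le_power) auto
  have a1: "a s \<ge> 1" and b1: "b s \<ge> 1" for s by (auto simp: a_def b_def)
  \<comment> \<open>This balance gives all the rescaled monomials
    \<open>x ^ (k * j) * y ^ (l * (N - j))\<close> the same denominator \<open>a ^ (k * N)\<close>,
    so rescaling respects the relation between the \<open>M j\<close>.\<close>
  have ab: "real (a s) ^ k = real (b s) ^ l" for s
    by (simp add: a_def b_def mult_ac flip: power_mult)
  have main: "(\<Sum>p\<in>E. \<Sum>s<S. box_kernel (a s) (fst p) * box_kernel (b s) (snd p) * (\<Sum>i\<le>N. (norm (M i p))\<^sup>2))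
      \<le> 48 * C0 ^ 4 / c * (\<Sum>i\<le>N. A i)\<^sup>2"
    if M: "\<And>i j. i \<le> N \<Longrightarrow> j \<le> N \<Longrightarrow> fourier_bound (M i) (M j) (A i * A j)"
      and M0: "\<And>m n. (\<Sum>j\<le>N. of_int (m ^ (k * j) * n ^ (l * (N - j))) * M j (m, n)) = 0"
      and E: "finite E"
    for M :: "nat \<Rightarrow> int \<times> int \<Rightarrow> complex" and A S E
  proof -
    \<comment> \<open>A window containing \<open>E\<close> and the supports of all kernels with
      \<open>s < S\<close>, so that every sum runs over one finite set.\<close>
    define L where "L = int (R * a S) + int (R * b S) + (\<Sum>p\<in>E. \<bar>fst p\<bar> + \<bar>snd p\<bar>)"
    define I where "I = {-L..L}"
    have sum_nonneg': "0 \<le> (\<Sum>p\<in>E. \<bar>fst p\<bar> + \<bar>snd p\<bar>)" by (intro sum_nonneg) auto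
    have EI: "E \<subseteq> I \<times> I"
    proof
      fix p assume "p \<in> E"
      then have "\<bar>fst p\<bar> + \<bar>snd p\<bar> \<le> (\<Sum>p\<in>E. \<bar>fst p\<bar> + \<bar>snd p\<bar>)"
        using E by (intro member_le_sum) auto
      then have "\<bar>fst p\<bar> + \<bar>snd p\<bar> \<le> L" unfolding L_def by linarith
      then have "\<bar>fst p\<bar> \<le> L" "\<bar>snd p\<bar> \<le> L" by linarith+
      then show "p \<in> I \<times> I" unfolding I_def by (cases p) auto
    qed
    have La: "int (R * a s) \<le> L" and Lb: "int (R * b s) \<le> L" if "s < S" for s
    proof -
      have "a s \<le> a S" "b s \<le> b S" using that by (auto simp: a_def b_def)
      then have "int (R * a s) \<le> int (R * a S)" "int (R * b s) \<le> int (R * b S)"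
        by (simp_all only: of_nat_le_iff mult_le_mono2)
      then show "int (R * a s) \<le> L" "int (R * b s) \<le> L"
        using sum_nonneg' unfolding L_def by linarith+
    qed
    have La': "int (a s) \<le> L" and Lb': "int (b s) \<le> L" if "s < S" for s
    proof -
      have "a s \<le> R * a s" "b s \<le> R * b s" using R2 by auto
      then have "int (a s) \<le> int (R * a s)" "int (b s) \<le> int (R * b s)" by (simp_all only: of_nat_le_iff)
      then show "int (a s) \<le> L" "int (b s) \<le> L" using La[OF that] Lb[OF that] by linarith+
    qed
    \<comment> \<open>The product of the \<open>i\<close>-th and \<open>j\<close>-th monomials
      factors into a function of \<open>m\<close> and one of \<open>n\<close>. \<open>T\<close> is
      the mass of this tensor kernel, and subtracting \<open>T\<close> times the box kernel
      \<open>\<beta>\<close> makes \<open>K\<close> mean-zero at each scale.\<close>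
    define f where "f s i j = mono_kernel R (k * i + k * j) (a s)" for s i j
    define g where "g s i j = mono_kernel R (l * (N - i) + l * (N - j)) (b s)" for s i j
    define T where "T s i j = (\<Sum>m\<in>I. f s i j m) * (\<Sum>n\<in>I. g s i j n)" for s i j
    define \<beta> where "\<beta> s p = box_kernel (a s) (fst p) * box_kernel (b s) (snd p)" for s p
    define K where "K i j p = (\<Sum>s<S. f s i j (fst p) * g s i j (snd p) - T s i j * \<beta> s p)" for i j p
    have T_trig: "of_real (T s i j) = trig I (f s i j) 1 * trig I (g s i j) 1" for s i j
      by (simp add: T_def trig_def)

    \<comment> \<open>The transform of \<open>K\<close> splits over the scales into mean-zero tensor
      differences, with the box kernels as the factors of mass 1; the scales grow by the ratios
      \<open>2 ^ l\<close> and \<open>2 ^ k\<close>.\<close>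
    have FT: "norm (\<Sum>(m, n)\<in>I \<times> I. of_real (K i j (m, n)) * (z powi m * w powi n)) \<le> 48 * C0 ^ 4"
      if ij: "i \<le> N" "j \<le> N" and zw: "norm z = 1" "norm w = 1" for i j and z w :: complex
    proof -
      have "(\<Sum>(m, n)\<in>I \<times> I. of_real (K i j (m, n)) * (z powi m * w powi n))
         = (\<Sum>(m, n)\<in>I \<times> I. \<Sum>s<S. (of_real (f s i j m) * z powi m) * (of_real (g s i j n) * w powi n)
             - of_real (T s i j) * ((of_real (box_kernel (a s) m) * z powi m) * (of_real (box_kernel (b s) n) * w powi n)))"
        by (intro sum.cong refl, clarify, unfold K_def of_real_sum sum_distrib_right prod.case, intro sum.cong refl)
           (simp add: \<beta>_def algebra_simps)
      also have "\<dots> = (\<Sum>s<S. \<Sum>(m, n)\<in>I \<times> I. (of_real (f s i j m) * z powi m) * (of_real (g s i j n) * w powi n)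
             - of_real (T s i j) * ((of_real (box_kernel (a s) m) * z powi m) * (of_real (box_kernel (b s) n) * w powi n)))"
        unfolding case_prod_unfold by (rule sum.swap)
      also have "\<dots> = (\<Sum>s<S. trig I (f s i j) z * trig I (g s i j) w - trig I (f s i j) 1 * trig I (g s i j) 1
           * (trig I (box_kernel (a s)) z * trig I (box_kernel (b s)) w))"
      proof (intro sum.cong refl)
        fix s
        have tensor: "trig I \<kappa> z * trig I \<kappa>' w
            = (\<Sum>p\<in>I \<times> I. (of_real (\<kappa> (fst p)) * z powi fst p) * (of_real (\<kappa>' (snd p)) * w powi snd p))" for \<kappa> \<kappa>'
          by (simp only: trig_def sum_product sum.cartesian_product case_prod_unfold)
        show "(\<Sum>(m, n)\<in>I \<times> I. (of_real (f s i j m) * z powi m) * (of_real (g s i j n) * w powi n)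
             - of_real (T s i j) * ((of_real (box_kernel (a s) m) * z powi m) * (of_real (box_kernel (b s) n) * w powi n)))
           = trig I (f s i j) z * trig I (g s i j) w - trig I (f s i j) 1 * trig I (g s i j) 1
             * (trig I (box_kernel (a s)) z * trig I (box_kernel (b s)) w)"
          by (simp only: case_prod_unfold sum_subtractf sum_distrib_left[symmetric] tensor[symmetric] T_trig)
      qed
      also have "norm \<dots> \<le> 48 * C0 ^ 4"
      proof (rule mean_zero_tensor_sum_bounded[where a = "\<lambda>s. real (a s)" and b = "\<lambda>s. real (b s)"
              and p = "2 ^ l" and q = "2 ^ k"])
        have le: "k * i + k * j \<le> 2 * k * N" "l * (N - i) + l * (N - j) \<le> 2 * l * N"
        proof -
          have "k * i \<le> k * N" "k * j \<le> k * N" "l * (N - i) \<le> l * N" "l * (N - j) \<le> l * N" using ij by auto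
          then show "k * i + k * j \<le> 2 * k * N" "l * (N - i) + l * (N - j) \<le> 2 * l * N" by linarith+
        qed
        fix s assume s: "s < S"
        show "adapted C0 (real (a s)) (trig I (f s i j))"
          unfolding I_def f_def
          by (rule adapted_mono[OF adapted_mono_kernel[OF a1 R2 La[OF s]]])
             (use R2 le in \<open>auto simp: C0_def intro!: power_increasing\<close>)
        show "adapted C0 (real (b s)) (trig I (g s i j))"
          unfolding I_def g_def
          by (rule adapted_mono[OF adapted_mono_kernel[OF b1 R2 Lb[OF s]]])
             (use R2 le in \<open>auto simp: C0_def intro!: power_increasing\<close>)
        show "adapted C0 (real (a s)) (trig I (box_kernel (a s)))"
          unfolding I_def by (rule adapted_mono[OF adapted_box_kernel[OF La'[OF s]] C0]) simp
        show "adapted C0 (real (b s)) (trig I (box_kernel (b s)))"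
          unfolding I_def by (rule adapted_mono[OF adapted_box_kernel[OF Lb'[OF s]] C0]) simp
        show "trig I (box_kernel (a s)) 1 = 1" "trig I (box_kernel (b s)) 1 = 1"
          unfolding I_def by (rule trig_box_kernel_one La'[OF s] Lb'[OF s])+
      next
        show "(2::real) \<le> 2 ^ l" "(2::real) \<le> 2 ^ k"
          using k l by (auto intro: self_le_power)
      qed (use C0 zw in \<open>auto simp: a_def b_def power_add\<close>)
      finally show ?thesis .
    qed

    \<comment> \<open>The left side is a multiple of the squared modulus of the compatibility condition \<open>M0\<close>.\<close>
    have vanish: "(\<Sum>i\<le>N. \<Sum>j\<le>N. of_real (f s i j m * g s i j n) * (M i (m, n) * cnj (M j (m, n)))) = 0" for s m n
    proof -
      define x where "x = real_of_int m / real (a s)"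
      define y where "y = real_of_int n / real (b s)"
      define \<gamma> where "\<gamma> j = x ^ (k * j) * y ^ (l * (N - j))" for j
      define \<theta> where "\<theta> = (if 1 \<le> m \<and> m \<le> int (R * a s) \<and> 1 \<le> n \<and> n \<le> int (R * b s) then 1 / (real (a s) * real (b s)) else 0)"
      have fg: "f s i j m * g s i j n = \<theta> * (\<gamma> i * \<gamma> j)" for i j
        by (auto simp: f_def g_def mono_kernel_def \<theta>_def \<gamma>_def x_def y_def power_add)
      have \<gamma>: "\<gamma> j = real_of_int (m ^ (k * j) * n ^ (l * (N - j))) / real (a s) ^ (k * N)" if "j \<le> N" for j
      proof -
        have "real (a s) ^ (k * j) * real (b s) ^ (l * (N - j)) = real (a s) ^ (k * j) * real (a s) ^ (k * (N - j))"
          by (simp only: power_mult ab)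
        also have "\<dots> = real (a s) ^ (k * N)"
          using that by (simp flip: power_add add_mult_distrib2)
        finally show ?thesis by (simp add: \<gamma>_def x_def y_def power_divide)
      qed
      have "(\<Sum>j\<le>N. of_real (\<gamma> j) * M j (m, n))
          = (\<Sum>j\<le>N. of_int (m ^ (k * j) * n ^ (l * (N - j))) * M j (m, n)) / of_real (real (a s) ^ (k * N))"
        unfolding sum_divide_distrib by (intro sum.cong refl) (simp add: \<gamma>)
      also have "\<dots> = 0" unfolding M0 by simp
      finally have 0: "(\<Sum>j\<le>N. of_real (\<gamma> j) * M j (m, n)) = 0" .
      have "(\<Sum>i\<le>N. \<Sum>j\<le>N. of_real (f s i j m * g s i j n) * (M i (m, n) * cnj (M j (m, n))))
          = of_real \<theta> * (\<Sum>i\<le>N. \<Sum>j\<le>N. of_real (\<gamma> i * \<gamma> j) * M i (m, n) * cnj (M j (m, n)))"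
        unfolding fg by (simp add: sum_distrib_left mult_ac)
      also have "\<dots> = 0" unfolding norm_sum_square_expand[symmetric] 0 by simp
      finally show ?thesis .
    qed

    \<comment> \<open>\<open>T s\<close> is a normalised sum of the rank-one matrices
      \<open>\<gamma> m n i * \<gamma> m n j\<close>, so its quadratic form is the sum of squares
      bounded below in \<open>gram\<close>.\<close>
    have posdef: "c * (\<Sum>j\<le>N. (norm (z j))\<^sup>2) \<le> Re (\<Sum>i\<le>N. \<Sum>j\<le>N. of_real (T s i j) * (z i * cnj (z j)))"
      if s: "s < S" for s and z :: "nat \<Rightarrow> complex"
    proof -
      define \<gamma> where "\<gamma> m n j = (real m / real (a s)) ^ (k * j) * (real n / real (b s)) ^ (l * (N - j))" for m n j
      have T: "T s i j = (\<Sum>m=1..R * a s. \<Sum>n=1..R * b s. \<gamma> m n i * \<gamma> m n j) / (real (a s) * real (b s))" for i j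
      proof -
        have F: "(\<Sum>m\<in>I. f s i j m) = (\<Sum>m=1..R * a s. (real m / real (a s)) ^ (k * i + k * j) / real (a s))"
          using sum_mono_kernel[OF La[OF s], of "k * i + k * j" "\<lambda>_. 1 :: real"] by (simp add: f_def I_def)
        have G: "(\<Sum>m\<in>I. g s i j m) = (\<Sum>n=1..R * b s. (real n / real (b s)) ^ (l * (N - i) + l * (N - j)) / real (b s))"
          using sum_mono_kernel[OF Lb[OF s], of "l * (N - i) + l * (N - j)" "\<lambda>_. 1 :: real"] by (simp add: g_def I_def)
        show ?thesis
          unfolding T_def F G \<gamma>_def sum_product sum_divide_distrib
          by (intro sum.cong refl) (simp add: power_add mult_ac)
      qed
      have "(\<Sum>i\<le>N. \<Sum>j\<le>N. of_real (T s i j) * (z i * cnj (z j)))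
         = (\<Sum>i\<le>N. \<Sum>j\<le>N. \<Sum>m=1..R * a s. \<Sum>n=1..R * b s. of_real (\<gamma> m n i * \<gamma> m n j) * z i * cnj (z j)) / of_real (real (a s) * real (b s))"
        unfolding T of_real_divide of_real_sum sum_divide_distrib sum_distrib_right
        by (intro sum.cong refl) (simp add: mult_ac)
      also have "(\<Sum>i\<le>N. \<Sum>j\<le>N. \<Sum>m=1..R * a s. \<Sum>n=1..R * b s. of_real (\<gamma> m n i * \<gamma> m n j) * z i * cnj (z j))
         = (\<Sum>m=1..R * a s. \<Sum>n=1..R * b s. \<Sum>i\<le>N. \<Sum>j\<le>N. of_real (\<gamma> m n i * \<gamma> m n j) * z i * cnj (z j))"
        (is "?l = ?r")
      proof -
        have "?l = (\<Sum>i\<le>N. \<Sum>m=1..R * a s. \<Sum>n=1..R * b s. \<Sum>j\<le>N. of_real (\<gamma> m n i * \<gamma> m n j) * z i * cnj (z j))"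
          by (rule sum.cong[OF refl], subst sum.swap, rule sum.cong[OF refl], rule sum.swap)
        also have "\<dots> = ?r"
          by (subst sum.swap, rule sum.cong[OF refl], rule sum.swap)
        finally show ?thesis .
      qed
      also have "\<dots> = of_real (\<Sum>m=1..R * a s. \<Sum>n=1..R * b s. (norm (\<Sum>j\<le>N. of_real (\<gamma> m n j) * z j))\<^sup>2)"
        unfolding norm_sum_square_expand[symmetric] by simp
      finally have "Re (\<Sum>i\<le>N. \<Sum>j\<le>N. of_real (T s i j) * (z i * cnj (z j)))
         = (\<Sum>m=1..R * a s. \<Sum>n=1..R * b s. (norm (\<Sum>j\<le>N. of_real (\<gamma> m n j) * z j))\<^sup>2) / (real (a s) * real (b s))"
        by (simp only: of_real_divide[symmetric] Re_complex_of_real)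
      then show ?thesis using gram[OF a1 b1, of z s s] by (simp only: \<gamma>_def)
    qed

    define Q where "Q s p = (\<Sum>i\<le>N. \<Sum>j\<le>N. of_real (T s i j) * (M i p * cnj (M j p)))" for s p
    define Z where "Z = (\<Sum>p\<in>I \<times> I. \<Sum>s<S. of_real (\<beta> s p) * Q s p)"
    have \<beta>0: "\<beta> s p \<ge> 0" for s p by (auto simp: \<beta>_def box_kernel_def)
    \<comment> \<open>When \<open>K i j\<close> is summed against \<open>M i * cnj (M j)\<close>,
      the part with \<open>f\<close> and \<open>g\<close> vanishes at every frequency and scale by
      \<open>vanish\<close>; only the box part, \<open>- Z\<close>, is left.\<close>
    have "(\<Sum>i\<le>N. \<Sum>j\<le>N. \<Sum>p\<in>I \<times> I. of_real (K i j p) * (M i p * cnj (M j p)))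
        = (\<Sum>p\<in>I \<times> I. \<Sum>i\<le>N. \<Sum>j\<le>N. of_real (K i j p) * (M i p * cnj (M j p)))"
      by (simp only: sum.swap[where B = "I \<times> I"])
    also have "\<dots> = (\<Sum>p\<in>I \<times> I. \<Sum>s<S. \<Sum>i\<le>N. \<Sum>j\<le>N.
          of_real (f s i j (fst p) * g s i j (snd p)) * (M i p * cnj (M j p))
          - of_real (\<beta> s p) * (of_real (T s i j) * (M i p * cnj (M j p))))"
    proof (rule sum.cong[OF refl])
      fix p
      have "(\<Sum>i\<le>N. \<Sum>j\<le>N. of_real (K i j p) * (M i p * cnj (M j p)))
         = (\<Sum>i\<le>N. \<Sum>j\<le>N. \<Sum>s<S. of_real (f s i j (fst p) * g s i j (snd p)) * (M i p * cnj (M j p))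
          - of_real (\<beta> s p) * (of_real (T s i j) * (M i p * cnj (M j p))))"
        by (intro sum.cong refl, unfold K_def of_real_sum sum_distrib_right, intro sum.cong refl)
           (simp add: algebra_simps)
      also have "\<dots> = (\<Sum>s<S. \<Sum>i\<le>N. \<Sum>j\<le>N. of_real (f s i j (fst p) * g s i j (snd p)) * (M i p * cnj (M j p))
          - of_real (\<beta> s p) * (of_real (T s i j) * (M i p * cnj (M j p))))"
        by (simp only: sum.swap[where B = "{..<S}"])
      finally show "(\<Sum>i\<le>N. \<Sum>j\<le>N. of_real (K i j p) * (M i p * cnj (M j p)))
         = (\<Sum>s<S. \<Sum>i\<le>N. \<Sum>j\<le>N. of_real (f s i j (fst p) * g s i j (snd p)) * (M i p * cnj (M j p))
          - of_real (\<beta> s p) * (of_real (T s i j) * (M i p * cnj (M j p))))" .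
    qed
    also have "\<dots> = - Z"
      unfolding Z_def Q_def sum_negf[symmetric]
    proof (intro sum.cong refl)
      fix p s
      show "(\<Sum>i\<le>N. \<Sum>j\<le>N. of_real (f s i j (fst p) * g s i j (snd p)) * (M i p * cnj (M j p))
          - of_real (\<beta> s p) * (of_real (T s i j) * (M i p * cnj (M j p))))
         = - (of_real (\<beta> s p) * (\<Sum>i\<le>N. \<Sum>j\<le>N. of_real (T s i j) * (M i p * cnj (M j p))))"
        using vanish[of s "fst p" "snd p"] by (simp only: sum_subtractf sum_distrib_left prod.collapse) simp
    qed
    finally have "norm Z = norm (\<Sum>i\<le>N. \<Sum>j\<le>N. \<Sum>p\<in>I \<times> I. of_real (K i j p) * (M i p * cnj (M j p)))"
      by simp
    also have "\<dots> \<le> (\<Sum>i\<le>N. \<Sum>j\<le>N. 48 * C0 ^ 4 * (A i * A j))"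
    proof (intro sum_norm_le)
      fix i j assume ij: "i \<in> {..N}" "j \<in> {..N}"
      have "finite (I \<times> I)" by (simp add: I_def)
      then show "norm (\<Sum>p\<in>I \<times> I. of_real (K i j p) * (M i p * cnj (M j p))) \<le> 48 * C0 ^ 4 * (A i * A j)"
        using M[of i j] FT[of i j] ij unfolding fourier_bound_def by simp
    qed
    also have "\<dots> = 48 * C0 ^ 4 * (\<Sum>i\<le>N. A i)\<^sup>2"
      unfolding power2_eq_square sum_product by (simp only: sum_distrib_left)
    finally have Z: "norm Z \<le> 48 * C0 ^ 4 * (\<Sum>i\<le>N. A i)\<^sup>2" .

    \<comment> \<open>Nonnegativity of the summands allows enlarging \<open>E\<close> to the whole
      window; \<open>posdef\<close> then compares them with those of \<open>Z\<close>
      pointwise.\<close>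
    have "c * (\<Sum>p\<in>E. \<Sum>s<S. \<beta> s p * (\<Sum>i\<le>N. (norm (M i p))\<^sup>2))
       \<le> c * (\<Sum>p\<in>I \<times> I. \<Sum>s<S. \<beta> s p * (\<Sum>i\<le>N. (norm (M i p))\<^sup>2))"
      using c EI by (intro mult_left_mono sum_mono2) (auto simp: I_def intro!: sum_nonneg mult_nonneg_nonneg \<beta>0)
    also have "\<dots> = (\<Sum>p\<in>I \<times> I. \<Sum>s<S. \<beta> s p * (c * (\<Sum>i\<le>N. (norm (M i p))\<^sup>2)))"
      by (simp add: sum_distrib_left mult_ac)
    also have "\<dots> \<le> (\<Sum>p\<in>I \<times> I. \<Sum>s<S. \<beta> s p * Re (Q s p))"
      unfolding Q_def by (intro sum_mono mult_left_mono posdef \<beta>0) auto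
    also have "\<dots> = Re Z" by (simp add: Z_def)
    also have "\<dots> \<le> norm Z" by (rule complex_Re_le_cmod)
    also note Z
    finally show ?thesis
      using c by (simp add: \<beta>_def pos_le_divide_eq mult_ac)
  qed
  show ?thesis
  proof (intro exI[of _ "48 * C0 ^ 4 / c"] conjI allI impI)
    show "0 \<le> 48 * C0 ^ 4 / c" using c C0 by simp
  qed (rule main[unfolded a_def b_def]; blast)
qed

subsection \<open>Complex measures on the torus\<close>

text \<open>Splitting the torus by the sign of \<open>Re h\<close> gives a partition into two sets
  that recovers the integral of the modulus of \<open>Re h\<close>. The same holds for
  \<open>Im h\<close>, and the two together give the factor 2.\<close>

lemma cmeasure_tv_ge_half_L1:
  assumes cm: "is_cmeasure \<nu> h"
  shows "(\<integral>t. norm (h t) \<partial>\<nu>) \<le> 2 * cmeasure_tv \<nu> h"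
proof -
  have int: "integrable \<nu> h" using cm by (simp add: is_cmeasure_def)
  let ?P = "{(\<Sum>A\<in>P. cmod (cmeasure_val \<nu> h A)) | P. finite P \<and> P \<subseteq> sets \<nu> \<and> disjoint P}"
  \<comment> \<open>A real supremum dominates the members of its set only if the set is bounded
    above; here the integral of \<open>norm (h t)\<close> is a bound.\<close>
  have bdd: "bdd_above ?P"
  proof (rule bdd_aboveI)
    fix x assume "x \<in> ?P"
    then obtain P where P: "finite P" "P \<subseteq> sets \<nu>" "disjoint P" "x = (\<Sum>A\<in>P. cmod (cmeasure_val \<nu> h A))"
      by blast
    have "x \<le> (\<Sum>A\<in>P. \<integral>t. norm (indicator A t *\<^sub>R h t) \<partial>\<nu>)"
      unfolding P(4) cmeasure_val_def set_lebesgue_integral_def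
      by (intro sum_mono integral_norm_bound)
    also have "\<dots> = (\<integral>t. (\<Sum>A\<in>P. norm (indicator A t *\<^sub>R h t)) \<partial>\<nu>)"
      using P int by (intro Bochner_Integration.integral_sum[symmetric] integrable_norm integrable_mult_indicator) auto
    also have "\<dots> \<le> (\<integral>t. norm (h t) \<partial>\<nu>)"
    proof (rule integral_mono)
      show "integrable \<nu> (\<lambda>t. \<Sum>A\<in>P. norm (indicator A t *\<^sub>R h t))"
        using P int by (intro Bochner_Integration.integrable_sum integrable_norm integrable_mult_indicator) auto
      show "integrable \<nu> (\<lambda>t. norm (h t))" using int by simp
      fix t
      have "(\<Sum>A\<in>P. indicator A t :: real) = indicator (\<Union>P) t"
      proof -
        have "disjoint_family_on (\<lambda>A. A) P"
          using P(3) by (auto simp: disjoint_family_on_def disjoint_def)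
        then have "(indicator (\<Union>A\<in>P. A) t :: real) = (\<Sum>A\<in>P. indicator A t)"
          by (rule indicator_UN_disjoint[OF P(1)])
        then show ?thesis by simp
      qed
      then have "(\<Sum>A\<in>P. norm (indicator A t *\<^sub>R h t)) = indicator (\<Union>P) t * norm (h t)"
        by (simp flip: sum_distrib_right)
      also have "\<dots> \<le> norm (h t)" by (simp add: indicator_def)
      finally show "(\<Sum>A\<in>P. norm (indicator A t *\<^sub>R h t)) \<le> norm (h t)" .
    qed
    finally show "x \<le> (\<integral>t. norm (h t) \<partial>\<nu>)" .
  qed
  have part: "norm (\<integral>t. indicator X t *\<^sub>R h t \<partial>\<nu>) + norm (\<integral>t. indicator (space \<nu> - X) t *\<^sub>R h t \<partial>\<nu>) \<le> cmeasure_tv \<nu> h"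
    if X: "X \<in> sets \<nu>" for X
  proof -
    let ?v = "\<lambda>A. cmod (cmeasure_val \<nu> h A)"
    have "?v X + ?v (space \<nu> - X) = (\<Sum>A\<in>{X, space \<nu> - X}. ?v A)"
    proof (cases "X = space \<nu> - X")
      \<comment> \<open>A set equals its complement only in an empty space. The pair then collapses
        to one element, but both terms are zero.\<close>
      case True
      then have "X = {}" "space \<nu> - X = {}" by auto
      then show ?thesis by (simp add: cmeasure_val_def set_lebesgue_integral_def)
    qed simp
    also have "\<dots> \<le> Sup ?P"
      using X by (intro cSup_upper[OF _ bdd]) (auto simp: disjoint_def)
    finally show ?thesis by (simp add: cmeasure_val_def cmeasure_tv_def set_lebesgue_integral_def)
  qed
  have real_part: "(\<integral>t. \<bar>f (h t)\<bar> \<partial>\<nu>) \<le> cmeasure_tv \<nu> h"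
    if f: "bounded_linear f" "\<And>z. f z \<le> norm z" for f :: "complex \<Rightarrow> real"
  proof -
    interpret f: bounded_linear f by fact
    define X where "X = {t \<in> space \<nu>. 0 \<le> f (h t)}"
    have fm: "(\<lambda>t. f (h t)) \<in> borel_measurable \<nu>" using integrable_bounded_linear[OF f(1) int] by auto
    have X: "X \<in> sets \<nu>" unfolding X_def using fm by measurable
    have i1: "integrable \<nu> (\<lambda>t. indicator X t *\<^sub>R h t)" "integrable \<nu> (\<lambda>t. indicator (space \<nu> - X) t *\<^sub>R h t)"
      using X int by (auto intro!: integrable_mult_indicator)
    have "(\<integral>t. \<bar>f (h t)\<bar> \<partial>\<nu>) = (\<integral>t. f (indicator X t *\<^sub>R h t) - f (indicator (space \<nu> - X) t *\<^sub>R h t) \<partial>\<nu>)"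
      by (intro Bochner_Integration.integral_cong refl) (auto simp: X_def indicator_def f.zero)
    also have "\<dots> = (\<integral>t. f (indicator X t *\<^sub>R h t) \<partial>\<nu>) - (\<integral>t. f (indicator (space \<nu> - X) t *\<^sub>R h t) \<partial>\<nu>)"
      by (intro Bochner_Integration.integral_diff integrable_bounded_linear[OF f(1)] i1)
    also have "\<dots> = f (\<integral>t. indicator X t *\<^sub>R h t \<partial>\<nu>) + f (- (\<integral>t. indicator (space \<nu> - X) t *\<^sub>R h t \<partial>\<nu>))"
      using integral_bounded_linear[OF f(1) i1(1)] integral_bounded_linear[OF f(1) i1(2)] by (simp add: f.neg)
    also have "\<dots> \<le> norm (\<integral>t. indicator X t *\<^sub>R h t \<partial>\<nu>) + norm (- (\<integral>t. indicator (space \<nu> - X) t *\<^sub>R h t \<partial>\<nu>))"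
      by (intro add_mono f)
    also have "\<dots> \<le> cmeasure_tv \<nu> h" using part[OF X] by simp
    finally show ?thesis .
  qed
  have "(\<integral>t. norm (h t) \<partial>\<nu>) \<le> (\<integral>t. \<bar>Re (h t)\<bar> + \<bar>Im (h t)\<bar> \<partial>\<nu>)"
    using int by (intro integral_mono) (auto simp: cmod_le)
  also have "\<dots> = (\<integral>t. \<bar>Re (h t)\<bar> \<partial>\<nu>) + (\<integral>t. \<bar>Im (h t)\<bar> \<partial>\<nu>)"
    using int by (intro Bochner_Integration.integral_add) auto
  also have "\<dots> \<le> cmeasure_tv \<nu> h + cmeasure_tv \<nu> h"
    by (intro add_mono real_part bounded_linear_Re bounded_linear_Im complex_Re_le_cmod)
       (metis abs_Im_le_cmod abs_le_D1)
  finally show ?thesis by simp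
qed

text \<open>Written through integer powers of points of the unit circle, to match
  \<open>z powi m * w powi n\<close> in \<open>fourier_bound\<close>. Being defined on the whole
  plane, it accepts differences of torus points without reduction modulo 1.\<close>

definition character :: "int \<times> int \<Rightarrow> real \<times> real \<Rightarrow> complex" where
  "character p t = cis (2 * pi * fst t) powi fst p * cis (2 * pi * snd t) powi snd p"

lemma norm_character [simp]: "norm (character p t) = 1"
  by (simp add: character_def norm_mult norm_power_int)

lemma character_diff: "character p (t' - t) = character p t' * cnj (character p t)"
proof -
  have *: "cis (2 * pi * (x - y)) powi m = cis (2 * pi * x) powi m * cnj (cis (2 * pi * y) powi m)" for x y m
    by (simp only: cis_power_int cis_cnj cis_mult) (simp add: algebra_simps)
  show ?thesis unfolding character_def fst_diff snd_diff * complex_cnj_mult by (simp only: mult_ac)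
qed

lemma cmeasure_fourier_character:
  "cmeasure_fourier \<nu> h p = (\<integral>t. h t * cnj (character p t) \<partial>\<nu>)"
proof -
  have "exp (- 2 * pi * \<i> * (of_int m * of_real (fst t) + of_int n * of_real (snd t))) = cnj (character (m, n) t)"
    for m n and t :: "real \<times> real"
  proof -
    have "character (m, n) t = cis (2 * pi * (of_int m * fst t + of_int n * snd t))"
      by (simp only: character_def cis_power_int cis_mult fst_conv snd_conv) (simp add: algebra_simps)
    then have "cnj (character (m, n) t) = cis (- (2 * pi * (of_int m * fst t + of_int n * snd t)))"
      by (simp only: cis_cnj)
    then show ?thesis by (simp add: cis_conv_exp algebra_simps)
  qed
  then show ?thesis by (cases p) (simp add: cmeasure_fourier_def)
qed

lemma integrable_times_character:
  assumes "is_cmeasure \<nu> h"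
  shows "integrable \<nu> (\<lambda>t. h t * cnj (character p t))"
proof -
  have h: "integrable \<nu> h" and s: "sets \<nu> = sets torus_borel" using assms by (auto simp: is_cmeasure_def)
  have "(\<lambda>t. cnj (character p t)) \<in> borel_measurable borel"
    unfolding character_def cis_power_int
    by (intro borel_measurable_continuous_onI continuous_intros)
  then have "(\<lambda>t. cnj (character p t)) \<in> borel_measurable \<nu>"
    using measurable_cong_sets[OF s refl] by (auto simp: torus_borel_def intro: measurable_restrict_space1)
  then show ?thesis using h
    by (intro Bochner_Integration.integrable_bound[OF h]) (auto simp: norm_mult)
qed

text \<open>Up to conjugation the sum is the integral of the transform of \<open>K\<close> at
  \<open>t - t'\<close> against the two measures. Estimating the integrals one after the other
  avoids a product measure. The constants \<open>\<omega>1\<close>, \<open>\<omega>2\<close> make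
  room for powers of \<open>2 * pi * \<i>\<close>.\<close>

lemma fourier_bound_cmeasure:
  assumes 1: "is_cmeasure \<nu>1 h1" and 2: "is_cmeasure \<nu>2 h2"
  shows "fourier_bound (\<lambda>p. \<omega>1 * cmeasure_fourier \<nu>1 h1 p) (\<lambda>p. \<omega>2 * cmeasure_fourier \<nu>2 h2 p)
     ((norm \<omega>1 * (\<integral>t. norm (h1 t) \<partial>\<nu>1)) * (norm \<omega>2 * (\<integral>t. norm (h2 t) \<partial>\<nu>2)))"
  unfolding fourier_bound_def
proof (intro allI impI)
  fix I and K :: "int \<times> int \<Rightarrow> real" and B
  assume I: "finite I" and B: "\<forall>z w :: complex. norm z = 1 \<longrightarrow> norm w = 1 \<longrightarrow>
    norm (\<Sum>(m, n)\<in>I. of_real (K (m, n)) * (z powi m * w powi n)) \<le> B"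
  have i1: "integrable \<nu>1 h1" and i2: "integrable \<nu>2 h2" using 1 2 by (auto simp: is_cmeasure_def)
  have Bt: "norm (\<Sum>p\<in>I. of_real (K p) * character p t) \<le> B" for t
    using B by (simp add: character_def case_prod_unfold)
  have inner: "norm (\<Sum>p\<in>I. of_real (K p) * character p t * cmeasure_fourier \<nu>2 h2 p) \<le> B * (\<integral>t. norm (h2 t) \<partial>\<nu>2)" for t
  proof -
    have "(\<Sum>p\<in>I. of_real (K p) * character p t * cmeasure_fourier \<nu>2 h2 p)
       = (\<integral>t'. (\<Sum>p\<in>I. of_real (K p) * character p t * (h2 t' * cnj (character p t'))) \<partial>\<nu>2)"
      unfolding cmeasure_fourier_character
      by (subst Bochner_Integration.integral_sum) (use integrable_times_character[OF 2] in auto)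
    also have "\<dots> = (\<integral>t'. h2 t' * (\<Sum>p\<in>I. of_real (K p) * character p (t - t')) \<partial>\<nu>2)"
      by (intro Bochner_Integration.integral_cong refl) (simp add: sum_distrib_left character_diff mult_ac)
    also have "norm \<dots> \<le> (\<integral>t'. norm (h2 t') * B \<partial>\<nu>2)"
    proof (rule Bochner_Integration.integral_norm_bound_integral)
      have "integrable \<nu>2 (\<lambda>t'. \<Sum>p\<in>I. of_real (K p) * character p t * (h2 t' * cnj (character p t')))"
        using integrable_times_character[OF 2] by auto
      then show "integrable \<nu>2 (\<lambda>t'. h2 t' * (\<Sum>p\<in>I. of_real (K p) * character p (t - t')))"
        by (simp add: sum_distrib_left character_diff mult_ac)
      show "integrable \<nu>2 (\<lambda>t'. norm (h2 t') * B)" using i2 by auto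
    qed (auto simp: norm_mult Bt intro: mult_left_mono)
    finally show ?thesis by (simp add: mult.commute)
  qed
  let ?F1 = "cmeasure_fourier \<nu>1 h1" and ?F2 = "cmeasure_fourier \<nu>2 h2"
  have "(\<Sum>p\<in>I. of_real (K p) * (?F1 p * cnj (?F2 p))) = (\<Sum>p\<in>I. of_real (K p) * cnj (?F2 p) * ?F1 p)"
    by (simp only: mult_ac)
  also have "\<dots> = (\<integral>t. (\<Sum>p\<in>I. of_real (K p) * cnj (?F2 p) * (h1 t * cnj (character p t))) \<partial>\<nu>1)"
    unfolding cmeasure_fourier_character[of \<nu>1]
    by (subst Bochner_Integration.integral_sum) (use integrable_times_character[OF 1] in auto)
  also have "norm \<dots> \<le> (\<integral>t. norm (h1 t) * (B * (\<integral>t. norm (h2 t) \<partial>\<nu>2)) \<partial>\<nu>1)"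
  proof (rule Bochner_Integration.integral_norm_bound_integral)
    show "integrable \<nu>1 (\<lambda>t. \<Sum>p\<in>I. of_real (K p) * cnj (?F2 p) * (h1 t * cnj (character p t)))"
      using integrable_times_character[OF 1] by auto
    show "integrable \<nu>1 (\<lambda>t. norm (h1 t) * (B * (\<integral>t. norm (h2 t) \<partial>\<nu>2)))" using i1 by auto
    fix t
    have "(\<Sum>p\<in>I. of_real (K p) * cnj (?F2 p) * (h1 t * cnj (character p t)))
       = h1 t * cnj (\<Sum>p\<in>I. of_real (K p) * character p t * ?F2 p)"
      by (simp add: sum_distrib_left mult_ac)
    then show "norm (\<Sum>p\<in>I. of_real (K p) * cnj (?F2 p) * (h1 t * cnj (character p t)))
        \<le> norm (h1 t) * (B * (\<integral>t. norm (h2 t) \<partial>\<nu>2))"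
      using mult_left_mono[OF inner[of t], of "norm (h1 t)"] by (simp only: norm_mult complex_mod_cnj) simp
  qed
  finally have le: "norm (\<Sum>p\<in>I. of_real (K p) * (?F1 p * cnj (?F2 p))) \<le> B * ((\<integral>t. norm (h1 t) \<partial>\<nu>1) * (\<integral>t. norm (h2 t) \<partial>\<nu>2))"
    by (simp add: mult_ac)
  have "(\<Sum>p\<in>I. of_real (K p) * ((\<omega>1 * ?F1 p) * cnj (\<omega>2 * ?F2 p)))
     = (\<omega>1 * cnj \<omega>2) * (\<Sum>p\<in>I. of_real (K p) * (?F1 p * cnj (?F2 p)))"
    by (simp add: sum_distrib_left mult_ac)
  also have "norm \<dots> \<le> (norm \<omega>1 * norm \<omega>2) * (B * ((\<integral>t. norm (h1 t) \<partial>\<nu>1) * (\<integral>t. norm (h2 t) \<partial>\<nu>2)))"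
    unfolding norm_mult complex_mod_cnj by (intro mult_left_mono le) auto
  finally show "norm (\<Sum>p\<in>I. of_real (K p) * ((\<omega>1 * ?F1 p) * cnj (\<omega>2 * ?F2 p)))
    \<le> B * ((norm \<omega>1 * (\<integral>t. norm (h1 t) \<partial>\<nu>1)) * (norm \<omega>2 * (\<integral>t. norm (h2 t) \<partial>\<nu>2)))"
    by (simp add: mult_ac)
qed

subsection \<open>Solutions of the chain of equations\<close>

text \<open>\<open>x\<close> and \<open>y\<close> stand for the multipliers of the two derivatives
  at one frequency. If \<open>norm y \<le> norm x\<close>, the chain is solved upwards from its
  first equation, otherwise downwards from its last; either way the preceding unknown enters with
  the smaller multiplier, so the bounds merely add up.\<close>

lemma chain_solution_bound:
  fixes \<phi> \<mu> :: "nat \<Rightarrow> complex"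
  assumes N: "N > 0"
    and first: "- (x * \<phi> 1) = \<mu> 0" and last: "y * \<phi> N = \<mu> N"
    and mid: "\<And>j. j \<in> {1..N-1} \<Longrightarrow> y * \<phi> j - x * \<phi> (j + 1) = \<mu> j"
    and j: "j \<in> {1..N}"
  shows "max (norm x) (norm y) * norm (\<phi> j) \<le> (\<Sum>i\<le>N. norm (\<mu> i))"
proof (cases "norm y \<le> norm x")
  case True
  have "norm x * norm (\<phi> (Suc i)) \<le> (\<Sum>i\<le>i. norm (\<mu> i))" if "i < N" for i
    using that
  proof (induction i)
    case 0
    have "norm x * norm (\<phi> 1) = norm (- (x * \<phi> 1))" by (simp add: norm_mult)
    also have "\<dots> = norm (\<mu> 0)" by (simp only: first)
    finally show ?case by simp
  next
    case (Suc i)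
    have "x * \<phi> (Suc (Suc i)) = y * \<phi> (Suc i) - \<mu> (Suc i)"
      using mid[of "Suc i"] Suc.prems by (simp add: algebra_simps)
    then have "norm x * norm (\<phi> (Suc (Suc i))) = norm (y * \<phi> (Suc i) - \<mu> (Suc i))"
      by (simp add: norm_mult[symmetric])
    also have "\<dots> \<le> norm y * norm (\<phi> (Suc i)) + norm (\<mu> (Suc i))"
      using norm_triangle_ineq4[of "y * \<phi> (Suc i)" "\<mu> (Suc i)"] by (simp add: norm_mult)
    also have "\<dots> \<le> norm x * norm (\<phi> (Suc i)) + norm (\<mu> (Suc i))"
      using True by (simp add: mult_right_mono)
    also have "\<dots> \<le> (\<Sum>i\<le>i. norm (\<mu> i)) + norm (\<mu> (Suc i))"
      using Suc by simp
    finally show ?case by simp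
  qed
  from this[of "j - 1"] have "norm x * norm (\<phi> j) \<le> (\<Sum>i\<le>j - 1. norm (\<mu> i))"
    using j by auto
  also have "\<dots> \<le> (\<Sum>i\<le>N. norm (\<mu> i))"
    using j by (intro sum_mono2) auto
  finally show ?thesis using True by (simp add: max_def)
next
  case False
  have "norm y * norm (\<phi> (N - i)) \<le> (\<Sum>i\<in>{N - i..N}. norm (\<mu> i))" if "i < N" for i
    using that
  proof (induction i)
    case 0
    then show ?case using last by (simp flip: norm_mult)
  next
    case (Suc i)
    define n where "n = N - Suc i"
    have n: "n \<in> {1..N-1}" "N - i = Suc n" using Suc.prems by (auto simp: n_def)
    have "y * \<phi> n = x * \<phi> (Suc n) + \<mu> n"
      using mid[OF n(1)] by (simp add: algebra_simps)
    then have "norm y * norm (\<phi> n) = norm (x * \<phi> (Suc n) + \<mu> n)"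
      by (simp add: norm_mult[symmetric])
    also have "\<dots> \<le> norm x * norm (\<phi> (Suc n)) + norm (\<mu> n)"
      using norm_triangle_ineq[of "x * \<phi> (Suc n)" "\<mu> n"] by (simp add: norm_mult)
    also have "\<dots> \<le> norm y * norm (\<phi> (Suc n)) + norm (\<mu> n)"
      using False by (simp add: mult_right_mono)
    also have "\<dots> \<le> (\<Sum>i\<in>{Suc n..N}. norm (\<mu> i)) + norm (\<mu> n)"
      using Suc n by simp
    also have "\<dots> = (\<Sum>i\<in>{n..N}. norm (\<mu> i))"
      using n by (subst sum.atLeast_Suc_atMost[of n N]) auto
    finally show ?case by (simp add: n_def)
  qed
  from this[of "N - j"] have "norm y * norm (\<phi> j) \<le> (\<Sum>i\<in>{j..N}. norm (\<mu> i))"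
    using j by auto
  also have "\<dots> \<le> (\<Sum>i\<le>N. norm (\<mu> i))"
    by (intro sum_mono2) auto
  finally show ?thesis using False by (simp add: max_def)
qed

text \<open>Weighting the \<open>j\<close>-th equation by \<open>x ^ j * y ^ (N - j)\<close> makes
  the sum of all equations telescope.\<close>

lemma chain_compatibility:
  fixes \<phi> \<mu> :: "nat \<Rightarrow> complex"
  assumes N: "N > 0"
    and first: "- (x * \<phi> 1) = \<mu> 0" and last: "y * \<phi> N = \<mu> N"
    and mid: "\<And>j. j \<in> {1..N-1} \<Longrightarrow> y * \<phi> j - x * \<phi> (j + 1) = \<mu> j"
  shows "(\<Sum>j\<le>N. x ^ j * y ^ (N - j) * \<mu> j) = 0"
proof -
  \<comment> \<open>After the equations \<open>0\<close> to \<open>i\<close> one boundary term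
    remains; for \<open>i = N - 1\<close> the last equation cancels it.\<close>
  have "(\<Sum>j\<le>i. x ^ j * y ^ (N - j) * \<mu> j) = - (x ^ Suc i * y ^ (N - i) * \<phi> (Suc i))" if "i < N" for i
    using that
  proof (induction i)
    case 0
    then show ?case by (simp flip: first)
  next
    case (Suc i)
    have Y: "y ^ (N - i) = y * y ^ (N - Suc i)"
      using Suc.prems by (metis Suc_diff_Suc Suc_lessD power_Suc)
    have \<mu>: "\<mu> (Suc i) = y * \<phi> (Suc i) - x * \<phi> (Suc (Suc i))"
      using mid[of "Suc i"] Suc.prems by simp
    show ?case using Suc by (simp add: Y \<mu> algebra_simps)
  qed
  from this[of "N - 1"] have "(\<Sum>j\<le>N - 1. x ^ j * y ^ (N - j) * \<mu> j) = - (x ^ N * y * \<phi> N)"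
    using N by simp
  moreover have "{..N} = insert N {..N - 1}" using N by auto
  ultimately show ?thesis using N by (simp flip: last)
qed

section \<open>The scale of a frequency and the Sobolev weight\<close>

lemma exists_scale:
  fixes m n :: int
  assumes k: "k > 0" and l: "l > 0" and m: "m \<noteq> 0" and n: "n \<noteq> 0"
  shows "\<exists>s. \<bar>m\<bar> \<le> 2 ^ (l * s) \<and> \<bar>n\<bar> \<le> 2 ^ (k * s) \<and>
     (2::real) ^ (k * l * s) \<le> 2 ^ (k * l) * max (\<bar>of_int m\<bar> ^ k) (\<bar>of_int n\<bar> ^ l)"
proof -
  define P where "P s \<longleftrightarrow> \<bar>m\<bar> \<le> 2 ^ (l * s) \<and> \<bar>n\<bar> \<le> 2 ^ (k * s)" for s
  have big: "t \<le> 2 ^ (d * s)" if "t \<le> int s" "d > 0" for t d s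
  proof -
    have "t \<le> int (2 ^ s)" using that(1) less_exp[of s] by linarith
    also have "\<dots> \<le> 2 ^ (d * s)" using that(2) by (simp add: power_increasing)
    finally show ?thesis .
  qed
  have "P (nat (\<bar>m\<bar> + \<bar>n\<bar>))"
    unfolding P_def using k l by (auto intro!: big)
  then have Ps: "P (LEAST s. P s)" by (rule LeastI)
  \<comment> \<open>At the least admissible scale the next smaller box misses \<open>(m, n)\<close>,
    which bounds the maximum from below. One step of \<open>s\<close> multiplies
    \<open>2 ^ (k * l * s)\<close> by the constant \<open>2 ^ (k * l)\<close> of the claim.\<close>
  define s where "s = (LEAST s. P s)"
  have "(2::real) ^ (k * l * s) \<le> 2 ^ (k * l) * max (\<bar>of_int m\<bar> ^ k) (\<bar>of_int n\<bar> ^ l)"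
  proof (cases s)
    case 0
    \<comment> \<open>There is no smaller box to compare with; instead \<open>m \<noteq> 0\<close>
      makes the maximum at least 1.\<close>
    have "1 \<le> \<bar>m\<bar>" using m by simp
    then have "1 \<le> \<bar>real_of_int m\<bar>" by linarith
    then have "1 * 1 \<le> 2 ^ (k * l) * max (\<bar>real_of_int m\<bar> ^ k) (\<bar>of_int n\<bar> ^ l)"
      by (intro mult_mono) (auto simp: le_max_iff_disj)
    then show ?thesis using 0 by simp
  next
    case (Suc t)
    then have "\<not> P t" using not_less_Least[of t P] by (simp add: s_def)
    then have "2 ^ (l * t) < \<bar>m\<bar> \<or> 2 ^ (k * t) < \<bar>n\<bar>" by (auto simp: P_def)
    then have "(2::real) ^ (k * l * t) \<le> max (\<bar>of_int m\<bar> ^ k) (\<bar>of_int n\<bar> ^ l)"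
    proof
      assume "2 ^ (l * t) < \<bar>m\<bar>"
      then have "real_of_int (2 ^ (l * t)) \<le> real_of_int \<bar>m\<bar>" by (simp only: of_int_le_iff)
      then have "(2 ^ (l * t)) ^ k \<le> \<bar>real_of_int m\<bar> ^ k" by (intro power_mono) auto
      then show ?thesis by (simp add: le_max_iff_disj mult_ac flip: power_mult)
    next
      assume "2 ^ (k * t) < \<bar>n\<bar>"
      then have "real_of_int (2 ^ (k * t)) \<le> real_of_int \<bar>n\<bar>" by (simp only: of_int_le_iff)
      then have "(2 ^ (k * t)) ^ l \<le> \<bar>real_of_int n\<bar> ^ l" by (intro power_mono) auto
      then show ?thesis by (simp add: le_max_iff_disj mult_ac flip: power_mult)
    qed
    then have "(2::real) ^ (k * l) * 2 ^ (k * l * t) \<le> 2 ^ (k * l) * max (\<bar>of_int m\<bar> ^ k) (\<bar>of_int n\<bar> ^ l)"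
      by (intro mult_left_mono) auto
    then show ?thesis using Suc by (simp add: power_add)
  qed
  then show ?thesis using Ps unfolding P_def s_def by blast
qed

lemma sobolev_weight_le:
  fixes m :: int
  assumes "m \<noteq> 0" and k: "k > 0"
  shows "(1 + (real_of_int m)\<^sup>2) powr ((real k - 1) / 2) \<le> 2 ^ k * \<bar>real_of_int m\<bar> ^ (k - 1)"
proof -
  have m1: "1 \<le> \<bar>real_of_int m\<bar>" using assms(1) by linarith
  have "1 + (real_of_int m)\<^sup>2 \<le> (2 * \<bar>real_of_int m\<bar>)\<^sup>2"
    using one_le_power[OF m1, of 2] by (simp add: power_mult_distrib)
  then have "(1 + (real_of_int m)\<^sup>2) powr ((real k - 1) / 2) \<le> ((2 * \<bar>real_of_int m\<bar>)\<^sup>2) powr ((real k - 1) / 2)"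
    using k by (intro powr_mono2) auto
  also have "(2 * \<bar>real_of_int m\<bar>)\<^sup>2 = (2 * \<bar>real_of_int m\<bar>) powr 2"
    using m1 by (simp add: powr_numeral)
  also have "((2 * \<bar>real_of_int m\<bar>) powr 2) powr ((real k - 1) / 2) = (2 * \<bar>real_of_int m\<bar>) powr (real (k - 1))"
  proof -
    have "2 * ((real k - 1) / 2) = real (k - 1)" using k by (simp add: of_nat_diff)
    then show ?thesis by (simp only: powr_powr)
  qed
  also have "\<dots> = (2 * \<bar>real_of_int m\<bar>) ^ (k - 1)"
    using m1 by (intro powr_realpow) auto
  also have "\<dots> \<le> 2 ^ k * \<bar>real_of_int m\<bar> ^ (k - 1)"
    unfolding power_mult_distrib by (intro mult_right_mono power_increasing) auto
  finally show ?thesis .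
qed

text \<open>At the scale of the frequency, \<open>a ^ k = b ^ l\<close> is at most a constant times
  the maximum, so the square of \<open>norm (\<phi> (m, n))\<close> is at most a constant times
  \<open>F\<^sup>2 / (a ^ k * b ^ l)\<close>, with \<open>F\<close> the sum of the
  \<open>norm (M i (m, n))\<close>. The squared weight is at most a constant times
  \<open>a ^ (k - 1) * b ^ (l - 1)\<close>. The product leaves \<open>1 / (a * b)\<close>, the size
  of the box kernels, which is why the orders are \<open>(k - 1) / 2\<close> and
  \<open>(l - 1) / 2\<close>.\<close>

lemma weighted_coefficient_bound:
  fixes \<phi> :: "int \<times> int \<Rightarrow> complex" and M :: "nat \<Rightarrow> int \<times> int \<Rightarrow> complex"
  assumes k: "k > 0" and l: "l > 0" and m: "m \<noteq> 0" and n: "n \<noteq> 0"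
    and \<phi>: "max (\<bar>of_int m\<bar> ^ k) (\<bar>of_int n\<bar> ^ l) * norm (\<phi> (m, n)) \<le> (\<Sum>i\<le>N. norm (M i (m, n)))"
  shows "\<exists>s. sob_weight_sq ((real k - 1) / 2) ((real l - 1) / 2) \<phi> (m, n)
    \<le> (9 * 2 ^ (k + l) * 4 ^ (k * l) * real (N + 1)) *
       (box_kernel (2 ^ (l * s)) m * box_kernel (2 ^ (k * s)) n * (\<Sum>i\<le>N. (norm (M i (m, n)))\<^sup>2))"
proof -
  obtain s where s: "\<bar>m\<bar> \<le> 2 ^ (l * s)" "\<bar>n\<bar> \<le> 2 ^ (k * s)"
    "(2::real) ^ (k * l * s) \<le> 2 ^ (k * l) * max (\<bar>of_int m\<bar> ^ k) (\<bar>of_int n\<bar> ^ l)"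
    using exists_scale[OF k l m n] by blast
  define a b :: real where "a = 2 ^ (l * s)" and "b = 2 ^ (k * s)"
  define F where "F = (\<Sum>i\<le>N. norm (M i (m, n)))"
  define F2 where "F2 = (\<Sum>i\<le>N. (norm (M i (m, n)))\<^sup>2)"
  have a1: "1 \<le> a" "1 \<le> b" by (auto simp: a_def b_def)
  have ma: "\<bar>real_of_int m\<bar> \<le> a" and nb: "\<bar>real_of_int n\<bar> \<le> b"
    using s(1,2) unfolding a_def b_def by (metis of_int_abs of_int_le_iff of_int_numeral of_int_power)+
  have ak: "a ^ k = 2 ^ (k * l * s)" "b ^ l = 2 ^ (k * l * s)"
    by (simp_all add: a_def b_def mult_ac flip: power_mult)
  have F0: "0 \<le> F" and F2: "F\<^sup>2 \<le> real (N + 1) * F2"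
    using sum_squared_le_sum_of_squares[of "\<lambda>i. norm (M i (m, n))" "{..N}"]
    by (auto simp: F_def F2_def sum_nonneg mult_ac add.commute)
  have "2 ^ (k * l * s) * norm (\<phi> (m, n)) \<le> 2 ^ (k * l) * max (\<bar>of_int m\<bar> ^ k) (\<bar>of_int n\<bar> ^ l) * norm (\<phi> (m, n))"
    using s(3) by (intro mult_right_mono) auto
  also have "\<dots> \<le> 2 ^ (k * l) * F"
    using \<phi> by (simp add: F_def mult.assoc mult_left_mono)
  finally have "(2 ^ (k * l * s) * norm (\<phi> (m, n)))\<^sup>2 \<le> (2 ^ (k * l) * F)\<^sup>2"
    by (intro power_mono) auto
  moreover have "(4::real) ^ (k * l) = 2 ^ (k * l) * 2 ^ (k * l)"
    by (simp flip: power_mult_distrib)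
  ultimately have 1: "(a ^ k * b ^ l) * (norm (\<phi> (m, n)))\<^sup>2 \<le> 4 ^ (k * l) * F\<^sup>2"
    unfolding ak by (simp add: power2_eq_square mult_ac)
  have "sob_weight_sq ((real k - 1) / 2) ((real l - 1) / 2) \<phi> (m, n)
      \<le> (2 ^ k * \<bar>real_of_int m\<bar> ^ (k - 1)) * (2 ^ l * \<bar>real_of_int n\<bar> ^ (l - 1)) * (norm (\<phi> (m, n)))\<^sup>2"
    unfolding sob_weight_sq_def prod.case
    by (intro mult_right_mono mult_mono sobolev_weight_le k l m n) auto
  also have "\<dots> \<le> (2 ^ k * a ^ (k - 1)) * (2 ^ l * b ^ (l - 1)) * (norm (\<phi> (m, n)))\<^sup>2"
    using ma nb a1 by (intro mult_right_mono mult_mono mult_left_mono power_mono mult_nonneg_nonneg) auto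
  also have "\<dots> = 2 ^ (k + l) * ((a ^ k * b ^ l) * (norm (\<phi> (m, n)))\<^sup>2) / (a * b)"
  proof -
    have "a ^ k = a * a ^ (k - 1)" "b ^ l = b * b ^ (l - 1)"
      using k l by (simp_all add: power_eq_if)
    then show ?thesis using a1 by (simp add: field_simps power_add)
  qed
  also have "\<dots> \<le> 2 ^ (k + l) * (4 ^ (k * l) * F\<^sup>2) / (a * b)"
    using 1 a1 by (intro divide_right_mono mult_left_mono) auto
  also have "\<dots> \<le> 2 ^ (k + l) * (4 ^ (k * l) * (real (N + 1) * F2)) / (a * b)"
    using F2 a1 by (intro divide_right_mono mult_left_mono) auto
  \<comment> \<open>The 9 anticipates \<open>1 / (3 * a)\<close> as a lower bound for the kernel
    height \<open>1 / (2 * a + 1)\<close>, and likewise for \<open>b\<close>.\<close>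
  also have "\<dots> = (9 * 2 ^ (k + l) * 4 ^ (k * l) * real (N + 1)) * (1 / (3 * a) * (1 / (3 * b)) * F2)"
    using a1 by (simp add: field_simps)
  also have "\<dots> \<le> (9 * 2 ^ (k + l) * 4 ^ (k * l) * real (N + 1)) *
     (box_kernel (2 ^ (l * s)) m * box_kernel (2 ^ (k * s)) n * F2)"
  proof (intro mult_left_mono mult_right_mono mult_mono)
    show "1 / (3 * a) \<le> box_kernel (2 ^ (l * s)) m"
      using s(1) a1 by (auto simp: box_kernel_def a_def intro!: divide_left_mono mult_pos_pos add_pos_pos)
    show "1 / (3 * b) \<le> box_kernel (2 ^ (k * s)) n"
      using s(2) a1 by (auto simp: box_kernel_def b_def intro!: divide_left_mono mult_pos_pos add_pos_pos)
  qed (use a1 in \<open>auto simp: F2_def box_kernel_def intro: sum_nonneg\<close>)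
  finally show ?thesis unfolding F2_def by blast
qed

section \<open>Summation over all frequencies\<close>

theorem theorem2:
  fixes k l N :: nat
  assumes "k > 0" and "l > 0" and "N > 0" and "odd k \<or> odd l"
  shows "\<exists>C::real. \<forall>(\<phi> :: nat \<Rightarrow> int \<times> int \<Rightarrow> complex)
      (\<nu> :: nat \<Rightarrow> (real \<times> real) measure) (h :: nat \<Rightarrow> real \<times> real \<Rightarrow> complex).
      (\<forall>j\<in>{1..N}. is_distribution (\<phi> j) \<and> proper (\<phi> j)) \<and>
      (\<forall>j\<in>{0..N}. is_cmeasure (\<nu> j) (h j)) \<and>
      (\<forall>p. - d1 k (\<phi> 1) p = cmeasure_fourier (\<nu> 0) (h 0) p) \<and>
      (\<forall>j\<in>{1..N-1}. \<forall>p. d2 l (\<phi> j) p - d1 k (\<phi> (j+1)) p = cmeasure_fourier (\<nu> j) (h j) p) \<and>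
      (\<forall>p. d2 l (\<phi> N) p = cmeasure_fourier (\<nu> N) (h N) p)
      \<longrightarrow> (\<forall>j\<in>{1..N}. in_W2 ((real k - 1) / 2) ((real l - 1) / 2) (\<phi> j)) \<and>
          (\<Sum>j=1..N. W2_norm ((real k - 1) / 2) ((real l - 1) / 2) (\<phi> j))
            \<le> C * (\<Sum>j=0..N. cmeasure_tv (\<nu> j) (h j))"
proof -
  obtain C where C: "C \<ge> 0" and est: "\<forall>(M :: nat \<Rightarrow> int \<times> int \<Rightarrow> complex) A S E.
    (\<forall>i\<le>N. \<forall>j\<le>N. fourier_bound (M i) (M j) (A i * A j)) \<longrightarrow>
    (\<forall>m n. (\<Sum>j\<le>N. of_int (m ^ (k * j) * n ^ (l * (N - j))) * M j (m, n)) = 0) \<longrightarrow> finite E \<longrightarrow>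
    (\<Sum>p\<in>E. \<Sum>s<S. box_kernel (2 ^ (l * s)) (fst p) * box_kernel (2 ^ (k * s)) (snd p) * (\<Sum>i\<le>N. (norm (M i p))\<^sup>2))
      \<le> C * (\<Sum>i\<le>N. A i)\<^sup>2"
    using frequency_estimate[OF assms(1,2), of N] by blast
  define C1 where "C1 = (9 * 2 ^ (k + l) * 4 ^ (k * l) * real (N + 1))"
  \<comment> \<open>Multiplying the transform of the \<open>j\<close>-th measure by
    \<open>\<omega> j\<close> turns the compatibility relation into one with integer weights. The
    moduli are at least 1, so the bound on the \<open>\<phi> j\<close> survives the change from
    \<open>\<mu>\<close> to \<open>M\<close>.\<close>
  define \<omega> :: "nat \<Rightarrow> complex" where "\<omega> j = (2 * pi * \<i>) ^ (k * j) * (2 * pi * \<i>) ^ (l * (N - j))" for j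
  define \<Omega> where "\<Omega> = (\<Sum>j\<le>N. norm (\<omega> j))"
  \<comment> \<open>The root undoes the quadratic estimate, the 2 compares the integral of
    \<open>norm (h i t)\<close> with the total variation, and \<open>\<Omega>\<close> bounds every
    \<open>norm (\<omega> i)\<close>.\<close>
  define C2 where "C2 = sqrt (C1 * C) * (2 * \<Omega>)"
  have C1: "C1 \<ge> 0" by (simp add: C1_def)
  have two_pi: "norm (2 * pi * \<i>) = 2 * pi" "1 \<le> 2 * pi"
    using pi_gt3 by (simp_all add: norm_mult)
  have \<omega>1: "1 \<le> norm (\<omega> j)" for j
  proof -
    have "1 * 1 \<le> (2 * pi) ^ (k * j) * (2 * pi) ^ (l * (N - j))"
      using two_pi by (intro mult_mono one_le_power) auto
    then show ?thesis unfolding \<omega>_def norm_mult[of "_ ^ _"] norm_power two_pi by simp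
  qed
  let ?w = "sob_weight_sq ((real k - 1) / 2) ((real l - 1) / 2)"
  have main: "in_W2 ((real k - 1) / 2) ((real l - 1) / 2) (\<phi> j) \<and>
      W2_norm ((real k - 1) / 2) ((real l - 1) / 2) (\<phi> j) \<le> C2 * (\<Sum>j=0..N. cmeasure_tv (\<nu> j) (h j))"
    if proper: "\<And>j. j \<in> {1..N} \<Longrightarrow> proper (\<phi> j)"
      and cm: "\<And>j. j \<le> N \<Longrightarrow> is_cmeasure (\<nu> j) (h j)"
      and eq0: "\<And>p. - d1 k (\<phi> 1) p = cmeasure_fourier (\<nu> 0) (h 0) p"
      and eqj: "\<And>j p. j \<in> {1..N-1} \<Longrightarrow> d2 l (\<phi> j) p - d1 k (\<phi> (j+1)) p = cmeasure_fourier (\<nu> j) (h j) p"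
      and eqN: "\<And>p. d2 l (\<phi> N) p = cmeasure_fourier (\<nu> N) (h N) p"
      and j: "j \<in> {1..N}"
    for \<phi> :: "nat \<Rightarrow> int \<times> int \<Rightarrow> complex" and \<nu> :: "nat \<Rightarrow> (real \<times> real) measure"
      and h :: "nat \<Rightarrow> real \<times> real \<Rightarrow> complex" and j
  proof -
    define \<mu> where "\<mu> i = cmeasure_fourier (\<nu> i) (h i)" for i
    define M where "M i p = \<omega> i * \<mu> i p" for i p
    define A where "A i = norm (\<omega> i) * (\<integral>t. norm (h i t) \<partial>\<nu> i)" for i
    define V where "V = (\<Sum>j=0..N. cmeasure_tv (\<nu> j) (h j))"
    have L1: "0 \<le> (\<integral>t. norm (h i t) \<partial>\<nu> i)" for i by simp
    have tv: "(\<integral>t. norm (h i t) \<partial>\<nu> i) \<le> 2 * cmeasure_tv (\<nu> i) (h i)" if "i \<le> N" for i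
      by (rule cmeasure_tv_ge_half_L1[OF cm[OF that]])
    have tv0: "0 \<le> cmeasure_tv (\<nu> i) (h i)" if "i \<le> N" for i
      using tv[OF that] L1[of i] by linarith
    have V0: "0 \<le> V" unfolding V_def using tv0 by (intro sum_nonneg) auto
    have A0: "0 \<le> (\<Sum>i\<le>N. A i)" unfolding A_def by (intro sum_nonneg mult_nonneg_nonneg L1) auto
    have "(\<Sum>i\<le>N. A i) \<le> (\<Sum>i\<le>N. \<Omega> * (2 * cmeasure_tv (\<nu> i) (h i)))"
      unfolding A_def \<Omega>_def
      by (intro sum_mono mult_mono tv member_le_sum sum_nonneg) auto
    also have "\<dots> = 2 * \<Omega> * V"
      by (simp add: V_def sum_distrib_left atLeast0AtMost mult_ac)
    finally have AV: "(\<Sum>i\<le>N. A i) \<le> 2 * \<Omega> * V" .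
    have chain: "- ((2 * pi * \<i> * of_int m) ^ k * \<phi> 1 (m, n)) = \<mu> 0 (m, n)"
      "(2 * pi * \<i> * of_int n) ^ l * \<phi> N (m, n) = \<mu> N (m, n)"
      "\<And>j. j \<in> {1..N-1} \<Longrightarrow> (2 * pi * \<i> * of_int n) ^ l * \<phi> j (m, n) - (2 * pi * \<i> * of_int m) ^ k * \<phi> (j + 1) (m, n) = \<mu> j (m, n)"
      for m n
      using eq0[of "(m, n)"] eqN[of "(m, n)"] eqj[of _ "(m, n)"] by (simp_all add: \<mu>_def d1_def d2_def)
    have fb: "fourier_bound (M i) (M j) (A i * A j)" if "i \<le> N" "j \<le> N" for i j
      unfolding M_def A_def \<mu>_def using fourier_bound_cmeasure[OF cm[OF that(1)] cm[OF that(2)]] .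
    have compat: "(\<Sum>j\<le>N. of_int (m ^ (k * j) * n ^ (l * (N - j))) * M j (m, n)) = 0" for m n
    proof -
      have "(\<Sum>j\<le>N. ((2 * pi * \<i> * of_int m) ^ k) ^ j * ((2 * pi * \<i> * of_int n) ^ l) ^ (N - j) * \<mu> j (m, n)) = 0"
        using chain_compatibility[OF assms(3) chain] by simp
      moreover have "((2 * pi * \<i> * of_int m) ^ k) ^ j * ((2 * pi * \<i> * of_int n) ^ l) ^ (N - j) * \<mu> j (m, n)
         = of_int (m ^ (k * j) * n ^ (l * (N - j))) * M j (m, n)" for j
      proof -
        have "((2 * pi * \<i> * of_int x) ^ d) ^ e = (2 * pi * \<i>) ^ (d * e) * of_int (x ^ (d * e))" for x d e
          by (simp only: power_mult[symmetric]) (simp only: power_mult_distrib of_int_power)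
        then show ?thesis
          unfolding M_def \<omega>_def by (simp only: of_int_mult mult_ac)
      qed
      ultimately show ?thesis by simp
    qed
    have weight: "\<exists>s. ?w (\<phi> j) p \<le> C1 * (box_kernel (2 ^ (l * s)) (fst p) * box_kernel (2 ^ (k * s)) (snd p) * (\<Sum>i\<le>N. (norm (M i p))\<^sup>2))" for p
    proof (cases "fst p = 0 \<or> snd p = 0")
      case True
      \<comment> \<open>Properness kills the coefficients on the axes, so any scale serves
        there.\<close>
      then have "\<phi> j p = 0" using proper[OF j] by (cases p) (auto simp: proper_def)
      then have "?w (\<phi> j) p = 0" by (cases p) (simp add: sob_weight_sq_def)
      then show ?thesis
        using C1 by (intro exI[of _ 0]) (auto simp: box_kernel_def intro!: mult_nonneg_nonneg sum_nonneg)
    next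
      case False
      obtain m n where p: "p = (m, n)" by (cases p)
      have "norm ((2 * pi * \<i> * of_int x) ^ e) = (2 * pi) ^ e * \<bar>real_of_int x\<bar> ^ e" for x e
        unfolding norm_power norm_mult[of _ "of_int _"] two_pi by (simp add: power_mult_distrib)
      moreover have "1 * \<bar>real_of_int x\<bar> ^ e \<le> (2 * pi) ^ e * \<bar>real_of_int x\<bar> ^ e" for x e
        using two_pi by (intro mult_right_mono one_le_power) auto
      ultimately have ge: "\<bar>real_of_int x\<bar> ^ e \<le> norm ((2 * pi * \<i> * of_int x) ^ e)" for x e
        by simp
      have "max (\<bar>of_int m\<bar> ^ k) (\<bar>of_int n\<bar> ^ l) * norm (\<phi> j (m, n))
         \<le> max (norm ((2 * pi * \<i> * of_int m) ^ k)) (norm ((2 * pi * \<i> * of_int n) ^ l)) * norm (\<phi> j (m, n))"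
        by (intro mult_right_mono max.mono ge) auto
      also have "\<dots> \<le> (\<Sum>i\<le>N. norm (\<mu> i (m, n)))"
        using chain_solution_bound[OF assms(3) chain j] by simp
      also have "\<dots> \<le> (\<Sum>i\<le>N. norm (M i (m, n)))"
        using mult_right_mono[OF \<omega>1] by (intro sum_mono) (simp add: M_def norm_mult)
      finally show ?thesis
        using weighted_coefficient_bound[OF assms(1,2), of m n "\<phi> j" M N] False by (simp add: p C1_def)
    qed
    then obtain s where s: "\<And>p. ?w (\<phi> j) p \<le> C1 * (box_kernel (2 ^ (l * s p)) (fst p) * box_kernel (2 ^ (k * s p)) (snd p) * (\<Sum>i\<le>N. (norm (M i p))\<^sup>2))"
      by metis
    have w0: "?w (\<phi> j) p \<ge> 0" for p by (cases p) (simp add: sob_weight_sq_def)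
    have fin: "(\<Sum>p\<in>E. ?w (\<phi> j) p) \<le> C1 * C * (2 * \<Omega> * V)\<^sup>2" if E: "finite E" for E
    proof -
      \<comment> \<open>One more than the largest scale used on \<open>E\<close>, because the scales
        run over \<open>s < S\<close>; the inserted 0 covers an empty \<open>E\<close>.\<close>
      define S where "S = Suc (Max (insert 0 (s ` E)))"
      have "s p < S" if "p \<in> E" for p
        using that E by (simp add: S_def less_Suc_eq_le)
      \<comment> \<open>The scale \<open>s p\<close> chosen for \<open>p\<close> contributes one
        term of a sum of nonnegative terms over all scales below \<open>S\<close>.\<close>
      then have "(\<Sum>p\<in>E. ?w (\<phi> j) p) \<le> (\<Sum>p\<in>E. C1 * (\<Sum>s<S. box_kernel (2 ^ (l * s)) (fst p) * box_kernel (2 ^ (k * s)) (snd p) * (\<Sum>i\<le>N. (norm (M i p))\<^sup>2)))"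
        by (intro sum_mono order_trans[OF s] mult_left_mono[OF _ C1]
              member_le_sum[where f = "\<lambda>s. box_kernel (2 ^ (l * s)) (fst _) * box_kernel (2 ^ (k * s)) (snd _) * (\<Sum>i\<le>N. (norm (M i _))\<^sup>2)"])
           (auto simp: box_kernel_def intro!: divide_nonneg_nonneg mult_nonneg_nonneg sum_nonneg)
      also have "\<dots> \<le> C1 * (C * (\<Sum>i\<le>N. A i)\<^sup>2)"
        unfolding sum_distrib_left[symmetric] by (intro mult_left_mono C1 est[rule_format] fb compat E)
      also have "\<dots> \<le> C1 * (C * (2 * \<Omega> * V)\<^sup>2)"
        by (intro mult_left_mono C1 C power_mono AV A0)
      finally show ?thesis by simp
    qed
    \<comment> \<open>The uniform bound on finite sums gives summability first, so the infinite sum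
      in the norm is a genuine value and not a default.\<close>
    have summ: "?w (\<phi> j) summable_on UNIV"
      by (rule nonneg_bdd_above_summable_on) (auto simp: w0 intro!: bdd_aboveI2 fin)
    have "(\<Sum>\<^sub>\<infinity>p. ?w (\<phi> j) p) \<le> C1 * C * (2 * \<Omega> * V)\<^sup>2"
      by (rule infsum_le_finite_sums[OF summ]) (use fin in auto)
    then have "sqrt (\<Sum>\<^sub>\<infinity>p. ?w (\<phi> j) p) \<le> sqrt (C1 * C * (2 * \<Omega> * V)\<^sup>2)"
      by simp
    also have "\<dots> = C2 * V"
      using V0 by (simp add: C2_def real_sqrt_mult real_sqrt_abs abs_mult \<Omega>_def abs_of_nonneg sum_nonneg)
    finally show ?thesis using summ by (simp add: in_W2_def W2_norm_def V_def)
  qed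
  show ?thesis
  proof (intro exI[of _ "real N * C2"] allI impI)
    fix \<phi> :: "nat \<Rightarrow> int \<times> int \<Rightarrow> complex" and \<nu> :: "nat \<Rightarrow> (real \<times> real) measure" and h :: "nat \<Rightarrow> real \<times> real \<Rightarrow> complex"
    assume *: "(\<forall>j\<in>{1..N}. is_distribution (\<phi> j) \<and> proper (\<phi> j)) \<and>
      (\<forall>j\<in>{0..N}. is_cmeasure (\<nu> j) (h j)) \<and>
      (\<forall>p. - d1 k (\<phi> 1) p = cmeasure_fourier (\<nu> 0) (h 0) p) \<and>
      (\<forall>j\<in>{1..N-1}. \<forall>p. d2 l (\<phi> j) p - d1 k (\<phi> (j+1)) p = cmeasure_fourier (\<nu> j) (h j) p) \<and>
      (\<forall>p. d2 l (\<phi> N) p = cmeasure_fourier (\<nu> N) (h N) p)"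
    have m: "in_W2 ((real k - 1) / 2) ((real l - 1) / 2) (\<phi> j) \<and>
      W2_norm ((real k - 1) / 2) ((real l - 1) / 2) (\<phi> j) \<le> C2 * (\<Sum>j=0..N. cmeasure_tv (\<nu> j) (h j))"
      if "j \<in> {1..N}" for j
      by (rule main) (use * that in auto)
    have "(\<Sum>j=1..N. W2_norm ((real k - 1) / 2) ((real l - 1) / 2) (\<phi> j))
        \<le> (\<Sum>j=1..N. C2 * (\<Sum>j=0..N. cmeasure_tv (\<nu> j) (h j)))"
      using m by (intro sum_mono) auto
    then show "(\<forall>j\<in>{1..N}. in_W2 ((real k - 1) / 2) ((real l - 1) / 2) (\<phi> j)) \<and>
          (\<Sum>j=1..N. W2_norm ((real k - 1) / 2) ((real l - 1) / 2) (\<phi> j))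
            \<le> real N * C2 * (\<Sum>j=0..N. cmeasure_tv (\<nu> j) (h j))"
      using m by simp
  qed
qed

end
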